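(* Let $(X,\mathsf{d},\mathsf{m})$ be a metric measure space satisfying $\mathrm{MCP}_{\mathrm{loc}}(K,N)$ for some $K\in\mathbb{R}$ and $N\in[1,\infty)$. Let $G$ be a discrete group of metric measure isometries, acting properly and freely. Then the metric measure quotient $(X^*,\mathsf{d}^*,\mathsf{m}^* )$ satisfies $\mathrm{MCP}_{\mathrm{loc}}(K,N)$. If $(X,\mathsf{d},\mathsf{m})$ is $\delta$-essentially non-branching, then $(X^*,\mathsf{d}^*,\mathsf{m}^* )$ is $\delta$-essentially non-branching.
   Context: Metric measure spaces. A metric measure space $(X,\mathsf{d},\mathsf{m})$ is a complete, separable, proper, geodesic metric space with a $\sigma$-finite Borel measure $\mathsf{m}$ with $\operatorname{supp}\mathsf{m}=X$. $\mathrm{Geo}(X)=\{\gamma\in C([0,1],X):\mathsf{d}(\gamma_s,\gamma_t)=|s-t|\mathsf{d}(\gamma_0,\gamma_1)\}$, $e_t(\gamma)=\gamma_t$. $\mathcal{P}_c(X)$ is the set of compactly supported Borel probability measures. $\mathrm{OptGeo}(\mu_0,\mu_1)$ is the set of probability measures $\nu$ on $\mathrm{Geo}(X)$ such that $(e_0,e_1)_\sharp\nu$ is an optimal coupling of $\mu_0,\mu_1$ for the cost $\mathsf{d}^2$. Distortion coefficients. For $K\in\mathbb{R}$, $N\in[1,\infty)$, $t\in[0,1]$, $\theta\ge 0$: $\tau^{t}_{K,N}(\theta)=\infty$ if $K>0$ and $K\theta^2\ge (N-1)\pi^2$; $\tau^{t}_{K,N}(\theta)=t^{1/N}\Big(\frac{\sin(t\theta\sqrt{K/(N-1)})}{\sin(\theta\sqrt{K/(N-1)})}\Big)^{1-1/N}$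 if $0<K\theta^2<(N-1)\pi^2$; $\tau^{t}_{K,N}(\theta)=t$ if $K\theta^2=0$, or $K<0$ and $N=1$; $\tau^{t}_{K,N}(\theta)=t^{1/N}\Big(\frac{\sinh(t\theta\sqrt{|K|/(N-1)})}{\sinh(\theta\sqrt{|K|/(N-1)})}\Big)^{1-1/N}$ if $K\theta^2<0$ (and $N>1$). Local MCP. $(X,\mathsf{d},\mathsf{m})$ satisfies $\mathrm{MCP}_{\mathrm{loc}}(K,N)$ if $X$ can be covered by open sets $\mathcal{O}\subset X$ such that for any $o\in\mathcal{O}$ and any $\mu_0\in\mathcal{P}_c(X)$ of the form $\mu_0=\frac{1}{\mathsf{m}(A)}\mathsf{m}|_A$, $A\subset\mathcal{O}$ Borel, $0<\mathsf{m}(A)<\infty$, there exists $\nu\in\mathrm{OptGeo}(\mu_0,\delta_o)$ with $\frac{1}{\mathsf{m}(A)}\mathsf{m}\ge (e_t)_\sharp\big(\tau^{(1-t)}_{K,N}(\mathsf{d}(\gamma_0,\gamma_1))^N\nu\big)$ for all $t\in[0,1]$ (the measures $(e_t)_\sharp\nu$ need not be supported in $\mathcal{O}$). $\delta$-essentially non-branching. A set $\Gamma\subset\mathrm{Geo}(X)$ is non-branching if for any $\gamma^1,\gamma^2\in\Gamma$ one has $\gamma^1=\gamma^2$ whenever there is $t\in(0,1)$ with $\gamma^1_s=\gamma^2_s$ for all $s\in[0,t]$. $(X,\mathsf{d},\mathsf{m})$ is $\delta$-essentially non-branching if for any $\mu_0\in\mathcal{P}_c(X)$ with $\mu_0\ll\mathsf{m}$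 and any probability measure $\mu_1=\sum_{j=1}^L\lambda_j\delta_{x_j}$ (finite sum, distinct points), any $\nu\in\mathrm{OptGeo}(\mu_0,\mu_1)$ is concentrated on a non-branching set of geodesics. Quotients. $G$ acts by metric measure isometries if the (continuous) action is by isometries, proper (i.e. $(g,x)\mapsto(gx,x)$ is a proper map), and $\mathsf{m}(gE)=\mathsf{m}(E)$ for all $g\in G$ and Borel $E$. $X^*=X/G$ is the orbit space with distance $\mathsf{d}^*(x^*,y^* )=\inf_{g\in G}\mathsf{d}(gx,y)$. For $G$ discrete acting properly and freely, the quotient map $\mathsf{q}:X\to X^*$ is a covering map and a local isometry, and $\mathsf{m}^*$ is the unique Borel measure such that $\mathsf{m}^*|_{\mathsf{q}(U)}=\mathsf{q}_\sharp(\mathsf{m}|_U)$ for every open $U\subset X$ on which $\mathsf{q}:U\to\mathsf{q}(U)$ is an isometry. *)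

theory Defs
  imports "HOL-Probability.Probability" "HOL-Algebra.Group_Action"
begin

section \<open>Distortion coefficients\<close>

text \<open>The cases are tried in the order in which they are listed. The first and third overlap only
  for \<open>K > 0\<close>, \<open>N = 1\<close>, \<open>\<theta> = 0\<close>, where the value is therefore \<open>\<infinity>\<close>.\<close>

definition tau :: "real \<Rightarrow> real \<Rightarrow> real \<Rightarrow> real \<Rightarrow> ennreal" where
  "tau K N t \<theta> =
     (if K > 0 \<and> K * \<theta>\<^sup>2 \<ge> (N - 1) * pi\<^sup>2 then \<infinity>
      else if 0 < K * \<theta>\<^sup>2 \<and> K * \<theta>\<^sup>2 < (N - 1) * pi\<^sup>2 then
        ennreal (t powr (1 / N) *
          (sin (t * \<theta> * sqrt (K / (N - 1))) / sin (\<theta> * sqrt (K / (N - 1)))) powr (1 - 1 / N))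
      else if K * \<theta>\<^sup>2 = 0 \<or> K < 0 \<and> N = 1 then ennreal t
      else
        ennreal (t powr (1 / N) *
          (sinh (t * \<theta> * sqrt (\<bar>K\<bar> / (N - 1))) / sinh (\<theta> * sqrt (\<bar>K\<bar> / (N - 1))))
            powr (1 - 1 / N)))"

text \<open>Real powers on \<open>[0, \<infinity>]\<close>; only used for positive exponents.\<close>

definition ennreal_powr :: "ennreal \<Rightarrow> real \<Rightarrow> ennreal" where
  "ennreal_powr x p = (if x = \<infinity> then \<infinity> else ennreal (enn2real x powr p))"

section \<open>Borel measures on metric spaces\<close>

definition borel_of :: "'a topology \<Rightarrow> 'a measure" where
  "borel_of T = sigma (topspace T) {U. openin T U}"

context Metric_space
begin

definition mborel :: "'a measure" where
  "mborel = borel_of mtopology"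

definition msupport :: "'a measure \<Rightarrow> 'a set" where
  "msupport \<mu> = {x \<in> M. \<forall>U. openin mtopology U \<and> x \<in> U \<longrightarrow> emeasure \<mu> U > 0}"

definition Pc :: "'a measure set" where
  "Pc = {\<mu>. sets \<mu> = sets mborel \<and> prob_space \<mu> \<and> compactin mtopology (msupport \<mu>)}"

section \<open>Geodesics and optimal transport\<close>

text \<open>Curves are represented by functions on \<^typ>\<open>real\<close> that are \<^const>\<open>undefined\<close> outside \<open>[0, 1]\<close>,
  so that curves agreeing on \<open>[0, 1]\<close> are equal; \<^const>\<open>cfunspace\<close> carries the supremum distance.\<close>

definition Geo :: "(real \<Rightarrow> 'a) set" where
  "Geo = {\<gamma> \<in> mspace (cfunspace (top_of_set {0..1}) (metric (M, d))).
            \<forall>s\<in>{0..1}. \<forall>t\<in>{0..1}. d (\<gamma> s) (\<gamma> t) = \<bar>s - t\<bar> * d (\<gamma> 0) (\<gamma> 1)}"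

definition Geo_topology :: "(real \<Rightarrow> 'a) topology" where
  "Geo_topology =
     subtopology (mtopology_of (cfunspace (top_of_set {0..1}) (metric (M, d)))) Geo"

text \<open>On a separable space, \<open>mborel \<Otimes>\<^sub>M mborel\<close> is the Borel algebra of the product.\<close>

definition couplings :: "'a measure \<Rightarrow> 'a measure \<Rightarrow> ('a \<times> 'a) measure set" where
  "couplings \<mu>0 \<mu>1 = {\<pi>. sets \<pi> = sets (mborel \<Otimes>\<^sub>M mborel) \<and>
      distr \<pi> mborel fst = \<mu>0 \<and> distr \<pi> mborel snd = \<mu>1}"

definition optimal_couplings :: "'a measure \<Rightarrow> 'a measure \<Rightarrow> ('a \<times> 'a) measure set" where
  "optimal_couplings \<mu>0 \<mu>1 = {\<pi> \<in> couplings \<mu>0 \<mu>1. \<forall>\<pi>' \<in> couplings \<mu>0 \<mu>1.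
      (\<integral>\<^sup>+ (x, y). ennreal ((d x y)\<^sup>2) \<partial>\<pi>) \<le> (\<integral>\<^sup>+ (x, y). ennreal ((d x y)\<^sup>2) \<partial>\<pi>')}"

definition OptGeo :: "'a measure \<Rightarrow> 'a measure \<Rightarrow> (real \<Rightarrow> 'a) measure set" where
  "OptGeo \<mu>0 \<mu>1 = {\<nu>. sets \<nu> = sets (borel_of Geo_topology) \<and> prob_space \<nu> \<and>
      distr \<nu> (mborel \<Otimes>\<^sub>M mborel) (\<lambda>\<gamma>. (\<gamma> 0, \<gamma> 1)) \<in> optimal_couplings \<mu>0 \<mu>1}"

definition non_branching :: "(real \<Rightarrow> 'a) set \<Rightarrow> bool" where
  "non_branching \<Gamma> \<longleftrightarrow> (\<forall>\<gamma>1\<in>\<Gamma>. \<forall>\<gamma>2\<in>\<Gamma>.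
      (\<exists>t\<in>{0<..<1}. \<forall>s\<in>{0..t}. \<gamma>1 s = \<gamma>2 s) \<longrightarrow> \<gamma>1 = \<gamma>2)"

text \<open>Finite convex combinations of Dirac measures at distinct points.\<close>

definition finite_dirac_sum :: "'a measure \<Rightarrow> bool" where
  "finite_dirac_sum \<mu> \<longleftrightarrow> sets \<mu> = sets mborel \<and> prob_space \<mu> \<and>
     (\<exists>(L::nat) (w::nat \<Rightarrow> real) x. inj_on x {1..L} \<and> x ` {1..L} \<subseteq> M \<and> (\<forall>j\<in>{1..L}. 0 \<le> w j) \<and>
        (\<forall>E\<in>sets mborel.
           emeasure \<mu> E = (\<Sum>j=1..L. ennreal (w j) * emeasure (return mborel (x j)) E)))"

end

section \<open>Metric measure spaces\<close>

locale metric_measure_space = Metric_space M d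
  for M :: "'a set" and d :: "'a \<Rightarrow> 'a \<Rightarrow> real" +
  fixes m :: "'a measure"
  assumes complete: "mcomplete"
    and separable: "separable_space mtopology"
    and proper: "\<And>x r. x \<in> M \<Longrightarrow> compactin mtopology (mcball x r)"
    and geodesic: "\<And>x y. x \<in> M \<Longrightarrow> y \<in> M \<Longrightarrow> \<exists>\<gamma>\<in>Geo. \<gamma> 0 = x \<and> \<gamma> 1 = y"
    and borel: "sets m = sets mborel"
    and sigma_finite: "sigma_finite_measure m"
    and full_support: "msupport m = M"
begin

definition MCP_loc :: "real \<Rightarrow> real \<Rightarrow> bool" where
  "MCP_loc K N \<longleftrightarrow> (\<exists>\<O>. \<Union>\<O> = M \<and> (\<forall>U\<in>\<O>. openin mtopology U \<and>
     (\<forall>p\<in>U. \<forall>A\<in>sets m.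
        A \<subseteq> U \<and> 0 < emeasure m A \<and> emeasure m A < \<infinity> \<and> uniform_measure m A \<in> Pc \<longrightarrow>
        (\<exists>\<nu>\<in>OptGeo (uniform_measure m A) (return mborel p). \<forall>t\<in>{0..1}. \<forall>E\<in>sets m.
           emeasure m E / emeasure m A \<ge>
           emeasure (distr (density \<nu> (\<lambda>\<gamma>. ennreal_powr (tau K N (1 - t) (d (\<gamma> 0) (\<gamma> 1))) N))
                      mborel (\<lambda>\<gamma>. \<gamma> t)) E))))"

text \<open>The almost-everywhere condition does not require \<open>\<Gamma>\<close> to be measurable; as subsets of
  non-branching sets are non-branching, \<open>\<Gamma>\<close> may equivalently be taken to be Borel.\<close>

definition delta_essentially_non_branching :: bool where
  "delta_essentially_non_branching \<longleftrightarrow>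
     (\<forall>\<mu>0\<in>Pc. \<forall>\<mu>1. absolutely_continuous m \<mu>0 \<and> finite_dirac_sum \<mu>1 \<longrightarrow>
        (\<forall>\<nu>\<in>OptGeo \<mu>0 \<mu>1. \<exists>\<Gamma>\<subseteq>Geo. non_branching \<Gamma> \<and> (AE \<gamma> in \<nu>. \<gamma> \<in> \<Gamma>)))"

section \<open>Group actions\<close>

text \<open>\<open>T\<close> is the topology of the group.\<close>

definition acts_by_mm_isometries ::
    "('g, 'b) monoid_scheme \<Rightarrow> 'g topology \<Rightarrow> ('g \<Rightarrow> 'a \<Rightarrow> 'a) \<Rightarrow> bool" where
  "acts_by_mm_isometries G T \<phi> \<longleftrightarrow>
     topspace T = carrier G \<and> group_action G M \<phi> \<and>
     continuous_map (prod_topology T mtopology) mtopology (\<lambda>(g, x). \<phi> g x) \<and>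
     (\<forall>g\<in>carrier G. \<forall>x\<in>M. \<forall>y\<in>M. d (\<phi> g x) (\<phi> g y) = d x y) \<and>
     proper_map (prod_topology T mtopology) (prod_topology mtopology mtopology)
       (\<lambda>(g, x). (\<phi> g x, x)) \<and>
     (\<forall>g\<in>carrier G. \<forall>E\<in>sets m. emeasure m (\<phi> g ` E) = emeasure m E)"

end

definition acts_freely :: "('g, 'b) monoid_scheme \<Rightarrow> 'a set \<Rightarrow> ('g \<Rightarrow> 'a \<Rightarrow> 'a) \<Rightarrow> bool" where
  "acts_freely G M \<phi> \<longleftrightarrow> (\<forall>g\<in>carrier G. \<forall>x\<in>M. \<phi> g x = x \<longrightarrow> g = \<one>\<^bsub>G\<^esub>)"

section \<open>Metric measure quotients\<close>

text \<open>The orbit space is \<^term>\<open>orbits G M \<phi>\<close> and the quotient map is \<^term>\<open>orbit G \<phi>\<close>. For an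
  isometric action the infimum below does not depend on the chosen representatives. Outside the orbit
  space the value is set to \<open>0\<close>, because \<^locale>\<open>Metric_space\<close> requires distances to be
  nonnegative and symmetric on the whole type.\<close>

definition quotient_dist ::
    "('g, 'b) monoid_scheme \<Rightarrow> ('g \<Rightarrow> 'a \<Rightarrow> 'a) \<Rightarrow> 'a set \<Rightarrow> ('a \<Rightarrow> 'a \<Rightarrow> real) \<Rightarrow>
     'a set \<Rightarrow> 'a set \<Rightarrow> real" where
  "quotient_dist G \<phi> M d X Y =
     (if X \<in> orbits G M \<phi> \<and> Y \<in> orbits G M \<phi>
      then INF g\<in>carrier G. d (\<phi> g (SOME x. x \<in> X)) (SOME y. y \<in> Y) else 0)"

definition is_quotient_measure ::
    "('g, 'b) monoid_scheme \<Rightarrow> ('g \<Rightarrow> 'a \<Rightarrow> 'a) \<Rightarrow> 'a set \<Rightarrow> ('a \<Rightarrow> 'a \<Rightarrow> real) \<Rightarrow> 'a measure \<Rightarrow>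
     'a set measure \<Rightarrow> bool" where
  "is_quotient_measure G \<phi> M d m \<mu> \<longleftrightarrow>
     sets \<mu> = sets (Metric_space.mborel (orbits G M \<phi>) (quotient_dist G \<phi> M d)) \<and>
     (\<forall>U. openin (Metric_space.mtopology M d) U \<and>
          (\<forall>x\<in>U. \<forall>y\<in>U. quotient_dist G \<phi> M d (orbit G \<phi> x) (orbit G \<phi> y) = d x y) \<longrightarrow>
          restrict_space \<mu> (orbit G \<phi> ` U) =
            distr (restrict_space m U) (restrict_space \<mu> (orbit G \<phi> ` U)) (orbit G \<phi>))"

definition quotient_measure ::
    "('g, 'b) monoid_scheme \<Rightarrow> ('g \<Rightarrow> 'a \<Rightarrow> 'a) \<Rightarrow> 'a set \<Rightarrow> ('a \<Rightarrow> 'a \<Rightarrow> real) \<Rightarrow> 'a measure \<Rightarrow>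
     'a set measure" where
  "quotient_measure G \<phi> M d m = (THE \<mu>. is_quotient_measure G \<phi> M d m \<mu>)"

end

theory Submission
  imports Defs
begin

text \<open>
  Write \<open>q\<close> for the quotient map. Properness of the action makes orbits locally finite, and freeness then bounds
  the displacement of the points of a ball by nontrivial group elements away from zero
  (\<open>displacement_bounded_below\<close>). Hence distances of orbits are attained, and, uniformly on balls,
  \<open>q\<close> preserves the distance of nearby points (\<open>dq_eq_d_if_close\<close>). Balls of the quotient are images of
  balls, so closed balls of the quotient are compact, which entails completeness; geodesics between nearest
  points of two orbits project to geodesics.

  The quotient measure is the push-forward of the restriction of \<open>m\<close> to a Borel fundamental domain,
  the image of a Borel section \<open>sect\<close> of \<open>q\<close>. Invariance of \<open>m\<close> shows that every Borel set of
  representatives yields the same values (\<open>emeasure_eq_if_same_orbits\<close>), which gives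
  the defining property on sheets; countably many sheets determine the measure.

  For the measure contraction property a small ball \<open>B\<close> around \<open>x\<close> is chosen inside a set of the
  given cover, such that \<open>q\<close> is isometric on the ball of three times the radius. A uniform measure on a
  subset of \<open>q ` B\<close> lifts to \<open>B\<close>, and a transport plan for the lift is projected. All geodesics
  involved stay in the larger ball, on which \<open>q\<close> identifies \<open>m\<close> with the quotient measure; so the
  inequality carries over (\<open>project_transport\<close>).

  For essential non-branching the transport plan goes the other way. A geodesic of the quotient has a
  unique lift with given starting point, and the lift is again a geodesic. Lifting from the starting
  points selected by \<open>sect\<close> is a Borel map, because it is continuous on each of countably many pieces
  (\<open>measurable_lift\<close>). It preserves the cost of a plan while projecting does not increase the cost of
  any competitor, so the lifted plan is optimal (\<open>lift_optimal\<close>). Its first marginal is absolutely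
  continuous with compact support, its second marginal is a finite sum of Dirac measures because
  bounded parts of orbits are finite. Hence the lifted plan is concentrated on a non-branching set,
  and by uniqueness of lifts so is the original one.
\<close>

section \<open>Borel sets of a topology\<close>

lemma space_borel_of [simp]: "space (borel_of T) = topspace T"
  unfolding borel_of_def by (rule space_measure_of) (auto dest: openin_subset)

lemma sets_borel_of: "sets (borel_of T) = sigma_sets (topspace T) {U. openin T U}"
  unfolding borel_of_def by (rule sets_measure_of) (auto dest: openin_subset)

lemma openin_borel_of: "openin T U \<Longrightarrow> U \<in> sets (borel_of T)"
  by (auto simp: sets_borel_of)

lemma closedin_borel_of:
  assumes "closedin T C"
  shows "C \<in> sets (borel_of T)"
proof -
  have "C = space (borel_of T) - (topspace T - C)"
    using closedin_subset[OF assms] by auto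
  also have "\<dots> \<in> sets (borel_of T)"
    using assms by (intro sets.compl_sets openin_borel_of) auto
  finally show ?thesis .
qed

lemma measurable_borel_ofI:
  assumes "f \<in> space N \<rightarrow> topspace T"
    and "\<And>U. openin T U \<Longrightarrow> f -` U \<inter> space N \<in> sets N"
  shows "f \<in> N \<rightarrow>\<^sub>M borel_of T"
  unfolding borel_of_def
  by (rule measurable_measure_of) (use assms in \<open>auto dest: openin_subset\<close>)

lemma measurable_continuous_map:
  assumes "continuous_map S T f"
  shows "f \<in> borel_of S \<rightarrow>\<^sub>M borel_of T"
proof (rule measurable_borel_ofI)
  show "f \<in> space (borel_of S) \<rightarrow> topspace T"
    using assms by (auto simp: continuous_map_def)
  fix U assume "openin T U"
  then have "openin S {x \<in> topspace S. f x \<in> U}"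
    using assms by (simp add: continuous_map_def)
  moreover have "{x \<in> topspace S. f x \<in> U} = f -` U \<inter> space (borel_of S)" by auto
  ultimately show "f -` U \<inter> space (borel_of S) \<in> sets (borel_of S)"
    by (metis openin_borel_of)
qed

lemma borel_measurable_continuous_map:
  assumes "continuous_map S euclidean f"
  shows "f \<in> borel_measurable (borel_of S)"
proof (rule borel_measurableI)
  fix U :: "'b set" assume "open U"
  then have "openin S {x \<in> topspace S. f x \<in> U}"
    using assms by (simp add: continuous_map_def)
  moreover have "{x \<in> topspace S. f x \<in> U} = f -` U \<inter> space (borel_of S)" by auto
  ultimately show "f -` U \<inter> space (borel_of S) \<in> sets (borel_of S)"
    by (metis openin_borel_of)
qed

context Metric_space
begin

lemma space_mborel [simp]: "space mborel = M"
  by (simp add: mborel_def)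

lemma openin_mborel: "openin mtopology U \<Longrightarrow> U \<in> sets mborel"
  by (simp add: mborel_def openin_borel_of)

lemma closedin_mborel: "closedin mtopology C \<Longrightarrow> C \<in> sets mborel"
  by (simp add: mborel_def closedin_borel_of)

lemma finite_mborel: "finite F \<Longrightarrow> F \<subseteq> M \<Longrightarrow> F \<in> sets mborel"
  by (intro closedin_mborel closedin_Hausdorff_finite Hausdorff_space_mtopology) auto

lemma dense_approx:
  assumes "mtopology closure_of C = M" "x \<in> M" "0 < e"
  obtains z where "z \<in> C" "z \<in> M" "d x z < e"
proof -
  have "x \<in> {x \<in> M. \<forall>r>0. \<exists>y\<in>C. y \<in> mball x r}"
    using assms(1,2) unfolding metric_closure_of by simp
  then show thesis
    using assms(3) that by fastforce
qed

lemma second_countable_mtopology: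
  assumes "separable_space mtopology"
  shows "second_countable mtopology"
proof -
  obtain C where C: "countable C" "C \<subseteq> M" "mtopology closure_of C = M"
    using assms by (auto simp: separable_space_def)
  define B where "B = (\<lambda>(c, r). mball c r) ` (C \<times> (\<rat> :: real set))"
  have "\<exists>V\<in>B. x \<in> V \<and> V \<subseteq> U" if U: "openin mtopology U" "x \<in> U" for U x
  proof -
    have x: "x \<in> M" using U openin_subset by fastforce
    obtain r where r: "r > 0" "mball x r \<subseteq> U"
      using openin_mtopology[of U] U by blast
    obtain c where c: "c \<in> C" "d x c < r / 2"
      using dense_approx[OF C(3) x, of "r / 2"] r(1) by auto
    obtain s where s: "s \<in> \<rat>" "d x c < s" "s < r / 2"
      using Rats_dense_in_real[OF c(2)] by auto
    have "c \<in> M" using c C by auto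
    have "mball c s \<subseteq> mball x r"
      using s \<open>c \<in> M\<close> x by (intro mball_subset) (auto simp: commute)
    then show ?thesis
      using c s \<open>c \<in> M\<close> x r
      by (intro bexI[of _ "mball c s"]) (auto simp: B_def commute intro!: image_eqI[of _ _ "(c, s)"])
  qed
  moreover have "countable B"
    unfolding B_def using C by (intro countable_image countable_SIGMA) (auto simp: countable_rat)
  moreover have "\<forall>V\<in>B. openin mtopology V"
    by (auto simp: B_def)
  ultimately show ?thesis
    unfolding second_countable_def by blast
qed

text \<open>The complement of the support is a union of null sets that belong to a countable base.\<close>

lemma AE_msupport:
  assumes "second_countable mtopology" and \<mu>: "sets \<mu> = sets mborel"
  shows "AE x in \<mu>. x \<in> msupport \<mu>"
proof -
  obtain B where B: "countable B" "\<And>V. V \<in> B \<Longrightarrow> openin mtopology V"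
    "\<And>U x. openin mtopology U \<Longrightarrow> x \<in> U \<Longrightarrow> \<exists>V\<in>B. x \<in> V \<and> V \<subseteq> U"
    using assms(1) unfolding second_countable_def by metis
  let ?N = "\<Union>V\<in>{V \<in> B. emeasure \<mu> V = 0}. V"
  have "?N \<in> null_sets \<mu>"
    using B \<mu> by (intro null_sets_UN') (auto intro!: null_setsI openin_mborel)
  moreover have "{x \<in> space \<mu>. \<not> x \<in> msupport \<mu>} \<subseteq> ?N"
  proof clarify
    fix x assume x: "x \<in> space \<mu>" "x \<notin> msupport \<mu>"
    then have "x \<in> M" using sets_eq_imp_space_eq[OF \<mu>] by simp
    with x obtain U where U: "openin mtopology U" "x \<in> U" "emeasure \<mu> U = 0"
      by (auto simp: msupport_def)
    then obtain V where V: "V \<in> B" "x \<in> V" "V \<subseteq> U" using B by blast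
    then have "emeasure \<mu> V = 0"
      using emeasure_mono[of V U \<mu>] U openin_mborel \<mu> by auto
    with V show "x \<in> ?N" by auto
  qed
  ultimately show ?thesis by (rule AE_I')
qed

lemma closedin_msupport: "closedin mtopology (msupport \<mu>)"
proof -
  have "M - msupport \<mu> = \<Union>{U. openin mtopology U \<and> emeasure \<mu> U = 0}"
    using openin_subset by (fastforce simp: msupport_def zero_less_iff_neq_zero)
  then have "openin mtopology (M - msupport \<mu>)" by auto
  then show ?thesis
    by (simp add: closedin_def) (auto simp: msupport_def)
qed

lemma compactin_msupport:
  assumes "AE y in \<mu>. y \<in> C" "compactin mtopology C" "sets \<mu> = sets mborel"
  shows "compactin mtopology (msupport \<mu>)"
proof -
  have C: "closedin mtopology C"
    using assms(2) Hausdorff_space_mtopology by (rule compactin_imp_closedin[rotated])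
  then have "M - C \<in> sets \<mu>" "C \<subseteq> M"
    using assms(3) by (auto intro!: openin_mborel dest: closedin_subset simp: closedin_def)
  then have "M - C \<in> null_sets \<mu>"
    using assms(1) sets_eq_imp_space_eq[OF assms(3)]
    by (auto simp: AE_iff_null_sets elim: eventually_mono)
  moreover have "openin mtopology (M - C)" using C by (simp add: closedin_def)
  ultimately have "x \<in> C" if "x \<in> msupport \<mu>" for x
    using that unfolding msupport_def by (metis (no_types, lifting) DiffI null_setsD1 less_irrefl mem_Collect_eq)
  then have "msupport \<mu> \<subseteq> C" by blast
  then show ?thesis
    using assms(2) closedin_msupport closed_compactin by blast
qed

lemma measurable_dist_point:
  assumes "z \<in> M"
  shows "(\<lambda>x. d x z) \<in> borel_measurable mborel"
  unfolding mborel_def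
  using assms continuous_map_mdist[of mtopology "metric (M, d)" "\<lambda>x. x" "\<lambda>x. z"]
  by (intro borel_measurable_continuous_map) (simp add: mtopology_of_def)

text \<open>Separability makes the distance measurable for the product algebra: it is the infimum of
  \<open>d x z + d z y\<close> over the points \<open>z\<close> of a countable dense set.\<close>

lemma measurable_dist_pair:
  assumes "separable_space mtopology"
  shows "(\<lambda>(x, y). ennreal ((d x y)\<^sup>2)) \<in> borel_measurable (mborel \<Otimes>\<^sub>M mborel)"
proof -
  obtain C where C: "countable C" "C \<subseteq> M" "mtopology closure_of C = M"
    using assms by (auto simp: separable_space_def)
  have eq: "ennreal (d x y) = (INF z\<in>C. ennreal (d x z) + ennreal (d z y))"
    if "x \<in> M" "y \<in> M" for x y
  proof (rule antisym)
    show "ennreal (d x y) \<le> (INF z\<in>C. ennreal (d x z) + ennreal (d z y))"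
      using C triangle that by (intro INF_greatest) (auto simp flip: ennreal_plus)
    show "(INF z\<in>C. ennreal (d x z) + ennreal (d z y)) \<le> ennreal (d x y)"
    proof (rule ennreal_le_epsilon)
      fix e :: real assume e: "e > 0"
      obtain z where z: "z \<in> C" "z \<in> M" "d x z < e / 2"
        using dense_approx[OF C(3) \<open>x \<in> M\<close>, of "e / 2"] e by auto
      have "d z y \<le> e / 2 + d x y"
        using z that triangle[of z x y] by (auto simp: commute)
      then have "ennreal (d x z) + ennreal (d z y) \<le> ennreal (d x y) + ennreal e"
        using z e by (auto simp flip: ennreal_plus intro!: ennreal_leI)
      then show "(INF z\<in>C. ennreal (d x z) + ennreal (d z y)) \<le> ennreal (d x y) + ennreal e"
        using z(1) by (meson INF_lower2)
    qed
  qed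
  have [measurable]: "(\<lambda>x. d x z) \<in> borel_measurable mborel" if "z \<in> C" for z
    using that C measurable_dist_point by auto
  have [measurable]: "(\<lambda>x. d z x) \<in> borel_measurable mborel" if "z \<in> C" for z
    using that C measurable_dist_point[of z] by (auto simp: commute)
  have "(\<lambda>p. INF z\<in>C. ennreal (d (fst p) z) + ennreal (d z (snd p)))
      \<in> borel_measurable (mborel \<Otimes>\<^sub>M mborel)"
    by (intro borel_measurable_INF C) measurable
  then have "(\<lambda>p. ennreal (d (fst p) (snd p))) \<in> borel_measurable (mborel \<Otimes>\<^sub>M mborel)"
    by (rule measurable_cong[THEN iffD1, rotated]) (auto simp: space_pair_measure eq)
  then have "(\<lambda>p. (ennreal (d (fst p) (snd p)))\<^sup>2) \<in> borel_measurable (mborel \<Otimes>\<^sub>M mborel)"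
    by measurable
  then show ?thesis
    by (simp add: ennreal_power split_beta')
qed

section \<open>Geodesics\<close>

lemma lipschitz_imp_continuous_map:
  assumes M: "\<And>t. t \<in> S \<Longrightarrow> c t \<in> M"
    and L: "\<And>s t. s \<in> S \<Longrightarrow> t \<in> S \<Longrightarrow> d (c s) (c t) \<le> L * \<bar>s - t\<bar>"
  shows "continuous_map (top_of_set S) mtopology (c :: real \<Rightarrow> 'a)"
proof -
  have "Lipschitz_continuous_map (submetric euclidean_metric S) (metric (M, d)) c"
    unfolding Lipschitz_continuous_map_def
    using M L by (auto simp: dist_real_def)
  then show ?thesis
    using Lipschitz_continuous_imp_continuous_map
    by (fastforce simp: mtopology_of_submetric)
qed

lemma Geo_iff:
  "\<gamma> \<in> Geo \<longleftrightarrow> \<gamma> \<in> extensional {0..1} \<and> (\<forall>t\<in>{0..1}. \<gamma> t \<in> M) \<and>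
    (\<forall>s\<in>{0..1}. \<forall>t\<in>{0..1}. d (\<gamma> s) (\<gamma> t) = \<bar>s - t\<bar> * d (\<gamma> 0) (\<gamma> 1))" (is "_ = ?R")
proof
  assume ?R
  then have "\<gamma> t \<in> M" "d (\<gamma> s) (\<gamma> t) \<le> d (\<gamma> 0) (\<gamma> 1) * \<bar>s - t\<bar>"
    if "s \<in> {0..1}" "t \<in> {0..1}" for s t
    using that by (blast, metis order_refl mult.commute)
  then have "continuous_map (top_of_set {0..1}) mtopology \<gamma>"
    by (rule lipschitz_imp_continuous_map)
  moreover have "compactin (top_of_set {0..1::real}) {0..1}"
    by (simp add: compactin_subtopology)
  ultimately have "compactin mtopology (\<gamma> ` {0..1})"
    by (rule image_compactin[rotated])
  then have "mbounded (\<gamma> ` {0..1})"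
    by (rule compactin_imp_mbounded)
  with \<open>continuous_map _ _ _\<close> \<open>?R\<close> show "\<gamma> \<in> Geo"
    unfolding Geo_def mspace_cfunspace mspace_metric mdist_metric mtopology_of
      topspace_euclidean_subtopology by blast
next
  assume "\<gamma> \<in> Geo"
  then show ?R
    unfolding Geo_def mspace_cfunspace mspace_metric topspace_euclidean_subtopology by blast
qed

lemma Geo_continuous_map:
  "\<gamma> \<in> Geo \<Longrightarrow> continuous_map (top_of_set {0..1}) mtopology \<gamma>"
  by (simp add: Geo_def)

lemma Geo_in_M: "\<gamma> \<in> Geo \<Longrightarrow> t \<in> {0..1} \<Longrightarrow> \<gamma> t \<in> M"
  by (simp add: Geo_iff)

lemma Geo_dist:
  "\<gamma> \<in> Geo \<Longrightarrow> s \<in> {0..1} \<Longrightarrow> t \<in> {0..1} \<Longrightarrow> d (\<gamma> s) (\<gamma> t) = \<bar>s - t\<bar> * d (\<gamma> 0) (\<gamma> 1)"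
  unfolding Geo_iff by blast

lemma const_Geo: "x \<in> M \<Longrightarrow> (\<lambda>t\<in>{0..1}. x) \<in> Geo"
  by (simp add: Geo_iff)

lemma topspace_Geo_topology [simp]: "topspace Geo_topology = Geo"
  by (auto simp: Geo_topology_def Geo_def)

text \<open>The supremum distance enters the later arguments only through uniform closeness of curves.\<close>

lemma openin_Geo_topology:
  "openin Geo_topology S \<longleftrightarrow> S \<subseteq> Geo \<and>
    (\<forall>\<gamma>\<in>S. \<exists>e>0. \<forall>\<eta>\<in>Geo. (\<forall>t\<in>{0..1}. d (\<gamma> t) (\<eta> t) < e) \<longrightarrow> \<eta> \<in> S)"
proof -
  let ?C = "cfunspace (top_of_set {0..1::real}) (metric (M, d))"
  have sub: "mspace (submetric ?C Geo) = Geo" by (auto simp: Geo_def)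
  interpret C: Metric_space Geo "mdist ?C"
    using Metric_space_mspace_mdist[of "submetric ?C Geo"] unfolding sub by simp
  have top: "Geo_topology = C.mtopology"
    unfolding Geo_topology_def
    unfolding mtopology_of_submetric[symmetric]
    unfolding mtopology_of_def sub by simp
  have le: "mdist ?C \<gamma> \<eta> \<le> a \<longleftrightarrow> (\<forall>t\<in>{0..1}. d (\<gamma> t) (\<eta> t) \<le> a)"
    if "\<gamma> \<in> Geo" "\<eta> \<in> Geo" for \<gamma> \<eta> a
    using that by (subst cfunspace_mdist_le) (auto simp: Geo_def)
  show ?thesis
  proof (cases "S \<subseteq> Geo")
    case True
    have "(\<exists>r>0. C.mball \<gamma> r \<subseteq> S) \<longleftrightarrow>
        (\<exists>e>0. \<forall>\<eta>\<in>Geo. (\<forall>t\<in>{0..1}. d (\<gamma> t) (\<eta> t) < e) \<longrightarrow> \<eta> \<in> S)"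
      if \<gamma>: "\<gamma> \<in> Geo" for \<gamma>
    proof
      assume "\<exists>r>0. C.mball \<gamma> r \<subseteq> S"
      then obtain r where r: "r > 0" "C.mball \<gamma> r \<subseteq> S" by blast
      have "\<eta> \<in> S" if "\<eta> \<in> Geo" "\<forall>t\<in>{0..1}. d (\<gamma> t) (\<eta> t) < r / 2" for \<eta>
      proof -
        have "mdist ?C \<gamma> \<eta> \<le> r / 2"
          using that(2) by (subst le[OF \<gamma> that(1)]) (auto intro: less_imp_le)
        then show ?thesis using r \<gamma> that by (intro subsetD[OF r(2)]) auto
      qed
      then show "\<exists>e>0. \<forall>\<eta>\<in>Geo. (\<forall>t\<in>{0..1}. d (\<gamma> t) (\<eta> t) < e) \<longrightarrow> \<eta> \<in> S"
        using r(1) by (intro exI[of _ "r / 2"]) auto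
    next
      assume "\<exists>e>0. \<forall>\<eta>\<in>Geo. (\<forall>t\<in>{0..1}. d (\<gamma> t) (\<eta> t) < e) \<longrightarrow> \<eta> \<in> S"
      then obtain e where e: "e > 0" "\<forall>\<eta>\<in>Geo. (\<forall>t\<in>{0..1}. d (\<gamma> t) (\<eta> t) < e) \<longrightarrow> \<eta> \<in> S" by blast
      have "C.mball \<gamma> e \<subseteq> S"
        using le \<gamma> by (auto intro!: e(2)[rule_format]) (smt (verit) atLeastAtMost_iff)
      then show "\<exists>r>0. C.mball \<gamma> r \<subseteq> S" using e by blast
    qed
    then show ?thesis
      using True unfolding top C.openin_mtopology by blast
  qed (auto simp: top C.openin_mtopology)
qed

lemma continuous_map_eval:
  assumes "t \<in> {0..1}"
  shows "continuous_map Geo_topology mtopology (\<lambda>\<gamma>. \<gamma> t)"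
  unfolding continuous_map_def
proof (intro conjI allI impI)
  show "(\<lambda>\<gamma>. \<gamma> t) \<in> topspace Geo_topology \<rightarrow> topspace mtopology"
    using assms Geo_in_M by auto
  fix U assume U: "openin mtopology U"
  show "openin Geo_topology {\<gamma> \<in> topspace Geo_topology. \<gamma> t \<in> U}"
    unfolding openin_Geo_topology
  proof (intro conjI ballI)
    fix \<gamma> assume "\<gamma> \<in> {\<gamma> \<in> topspace Geo_topology. \<gamma> t \<in> U}"
    then have \<gamma>: "\<gamma> \<in> Geo" "\<gamma> t \<in> U" by auto
    with U obtain e where "e > 0" "mball (\<gamma> t) e \<subseteq> U" by (auto simp: openin_mtopology)
    then show "\<exists>e>0. \<forall>\<eta>\<in>Geo. (\<forall>t\<in>{0..1}. d (\<gamma> t) (\<eta> t) < e) \<longrightarrow>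
        \<eta> \<in> {\<gamma> \<in> topspace Geo_topology. \<gamma> t \<in> U}"
      using assms \<gamma> Geo_in_M by (intro exI[of _ e]) (auto simp: subset_iff)
  qed auto
qed

lemma measurable_eval:
  "t \<in> {0..1} \<Longrightarrow> (\<lambda>\<gamma>. \<gamma> t) \<in> borel_of Geo_topology \<rightarrow>\<^sub>M mborel"
  unfolding mborel_def by (intro measurable_continuous_map continuous_map_eval)

lemma measurable_endpoints:
  "(\<lambda>\<gamma>. (\<gamma> 0, \<gamma> 1)) \<in> borel_of Geo_topology \<rightarrow>\<^sub>M mborel \<Otimes>\<^sub>M mborel"
  by (intro measurable_Pair measurable_eval) auto

lemma measurable_length:
  "(\<lambda>\<gamma>. d (\<gamma> 0) (\<gamma> 1)) \<in> borel_measurable (borel_of Geo_topology)"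
  using continuous_map_mdist[of Geo_topology "metric (M, d)" "\<lambda>\<gamma>. \<gamma> 0" "\<lambda>\<gamma>. \<gamma> 1"]
    continuous_map_eval[of 0] continuous_map_eval[of 1]
  by (intro borel_measurable_continuous_map) simp

end

lemma measurable_sinh [measurable]: "(sinh :: real \<Rightarrow> real) \<in> borel_measurable borel"
  by (intro borel_measurable_continuous_onI continuous_intros)

lemma measurable_tau [measurable]: "tau K N t \<in> borel_measurable borel"
  unfolding tau_def[abs_def] by measurable

lemma measurable_ennreal_powr [measurable]: "(\<lambda>x. ennreal_powr x p) \<in> borel_measurable borel"
  unfolding ennreal_powr_def by measurable

context Metric_space
begin

lemma measurable_distortion:
  "(\<lambda>\<gamma>. ennreal_powr (tau K N t (d (\<gamma> 0) (\<gamma> 1))) N) \<in> borel_measurable (borel_of Geo_topology)"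
  using measurable_length by measurable

section \<open>Transport to finitely many points\<close>

lemma AE_return_mborel:
  assumes p: "p \<in> M"
  shows "AE y in return mborel p. y = p"
proof -
  have "{p} \<in> sets mborel" using p by (intro finite_mborel) auto
  then show ?thesis
    using p by (subst AE_return) (auto simp: pred_def cong: conj_cong intro!: sets.sets_Collect)
qed

text \<open>In a coupling with a Dirac measure the second coordinate is almost surely constant, so its
  cost depends only on the first marginal.\<close>

lemma couplings_dirac_optimal:
  assumes p: "p \<in> M" and \<pi>: "\<pi> \<in> couplings \<mu>0 (return mborel p)"
  shows "\<pi> \<in> optimal_couplings \<mu>0 (return mborel p)"
proof -
  have cost: "(\<integral>\<^sup>+ (x, y). ennreal ((d x y)\<^sup>2) \<partial>\<pi>) = (\<integral>\<^sup>+ x. ennreal ((d x p)\<^sup>2) \<partial>\<mu>0)"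
    if "\<pi> \<in> couplings \<mu>0 (return mborel p)" for \<pi>
  proof -
    have \<pi>: "sets \<pi> = sets (mborel \<Otimes>\<^sub>M mborel)"
      "distr \<pi> mborel fst = \<mu>0" "distr \<pi> mborel snd = return mborel p"
      using that by (auto simp: couplings_def)
    have fst: "fst \<in> \<pi> \<rightarrow>\<^sub>M mborel" and snd: "snd \<in> \<pi> \<rightarrow>\<^sub>M mborel"
      by (simp_all add: measurable_cong_sets[OF \<pi>(1) refl])
    have "AE y in return mborel p. y = p" using p by (rule AE_return_mborel)
    then have "AE z in \<pi>. snd z = p"
      unfolding \<pi>(3)[symmetric] by (rule AE_distrD[OF snd])
    then have "(\<integral>\<^sup>+ (x, y). ennreal ((d x y)\<^sup>2) \<partial>\<pi>) = (\<integral>\<^sup>+ z. ennreal ((d (fst z) p)\<^sup>2) \<partial>\<pi>)"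
      by (intro nn_integral_cong_AE) (auto elim!: eventually_mono)
    also have "\<dots> = (\<integral>\<^sup>+ x. ennreal ((d x p)\<^sup>2) \<partial>\<mu>0)"
      unfolding \<pi>(2)[symmetric] using measurable_dist_point[OF p]
      by (subst nn_integral_distr[OF fst]) auto
    finally show ?thesis .
  qed
  then show ?thesis
    using \<pi> by (auto simp: optimal_couplings_def)
qed

lemma OptGeo_marginals:
  assumes "\<nu> \<in> OptGeo \<mu>0 \<mu>1"
  shows "sets \<nu> = sets (borel_of Geo_topology)" "prob_space \<nu>"
    "distr \<nu> mborel (\<lambda>\<gamma>. \<gamma> 0) = \<mu>0" "distr \<nu> mborel (\<lambda>\<gamma>. \<gamma> 1) = \<mu>1"
proof -
  show s: "sets \<nu> = sets (borel_of Geo_topology)" and "prob_space \<nu>"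
    using assms by (auto simp: OptGeo_def)
  have e: "(\<lambda>\<gamma>. (\<gamma> 0, \<gamma> 1)) \<in> \<nu> \<rightarrow>\<^sub>M mborel \<Otimes>\<^sub>M mborel"
    using measurable_endpoints by (simp add: measurable_cong_sets[OF s refl])
  show "distr \<nu> mborel (\<lambda>\<gamma>. \<gamma> 0) = \<mu>0" "distr \<nu> mborel (\<lambda>\<gamma>. \<gamma> 1) = \<mu>1"
    using assms distr_distr[OF measurable_fst e] distr_distr[OF measurable_snd e]
    by (auto simp: OptGeo_def optimal_couplings_def couplings_def comp_def)
qed

lemma endpoint_coupling:
  assumes s: "sets \<nu> = sets (borel_of Geo_topology)"
    and "distr \<nu> mborel (\<lambda>\<gamma>. \<gamma> 0) = \<mu>0" "distr \<nu> mborel (\<lambda>\<gamma>. \<gamma> 1) = \<mu>1"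
  shows "distr \<nu> (mborel \<Otimes>\<^sub>M mborel) (\<lambda>\<gamma>. (\<gamma> 0, \<gamma> 1)) \<in> couplings \<mu>0 \<mu>1"
proof -
  have e: "(\<lambda>\<gamma>. (\<gamma> 0, \<gamma> 1)) \<in> \<nu> \<rightarrow>\<^sub>M mborel \<Otimes>\<^sub>M mborel"
    using measurable_endpoints by (simp add: measurable_cong_sets[OF s refl])
  show ?thesis
    using assms distr_distr[OF measurable_fst e] distr_distr[OF measurable_snd e]
    by (auto simp: couplings_def comp_def)
qed

lemma emeasure_distr_eval:
  assumes s: "sets \<nu> = sets (borel_of Geo_topology)"
    and f: "f \<in> borel_measurable (borel_of Geo_topology)"
    and t: "t \<in> {0..1}" and E: "E \<in> sets mborel"
  shows "emeasure (distr (density \<nu> f) mborel (\<lambda>\<gamma>. \<gamma> t)) E =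
    (\<integral>\<^sup>+ \<gamma>. f \<gamma> * indicator E (\<gamma> t) \<partial>\<nu>)"
proof -
  have e: "(\<lambda>\<gamma>. \<gamma> t) \<in> density \<nu> f \<rightarrow>\<^sub>M mborel"
    using measurable_eval[OF t] by (simp add: measurable_cong_sets[OF s refl])
  have "(\<lambda>\<gamma>. \<gamma> t) -` E \<inter> space (density \<nu> f) \<in> sets \<nu>"
    using measurable_sets[OF e E] by simp
  then show ?thesis
    using f E by (subst emeasure_distr[OF e], simp, subst emeasure_density)
      (auto simp: measurable_cong_sets[OF s refl] indicator_def intro!: nn_integral_cong)
qed

text \<open>Being concentrated on a finite set is a form of \<open>finite_dirac_sum\<close> that is easily seen to be
  inherited by lifts; the two implications between these notions follow.\<close>

lemma AE_finite_if_finite_dirac_sum: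
  assumes "finite_dirac_sum \<mu>"
  shows "\<exists>F\<subseteq>M. finite F \<and> (AE x in \<mu>. x \<in> F)"
proof -
  obtain L :: nat and w :: "nat \<Rightarrow> real" and x where L: "x ` {1..L} \<subseteq> M" and
    \<mu>: "\<And>E. E \<in> sets mborel \<Longrightarrow>
      emeasure \<mu> E = (\<Sum>j=1..L. ennreal (w j) * emeasure (return mborel (x j)) E)"
    and sets: "sets \<mu> = sets mborel"
    using assms unfolding finite_dirac_sum_def by blast
  let ?F = "x ` {1..L}"
  have N: "M - ?F \<in> sets mborel"
    using finite_mborel[OF _ L] sets.compl_sets[of ?F mborel] by auto
  then have "emeasure \<mu> (M - ?F) = 0"
    by (auto simp: \<mu>)
  then have "AE y in \<mu>. y \<in> ?F"
    using N sets sets_eq_imp_space_eq[OF sets] by (intro AE_I[of _ _ "M - ?F"]) auto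
  then show ?thesis
    using L by (intro exI[of _ ?F]) auto
qed

lemma finite_dirac_sum_if_AE_finite:
  assumes sets: "sets \<mu> = sets mborel" and "prob_space \<mu>"
    and F: "finite F" "F \<subseteq> M" and AE: "AE x in \<mu>. x \<in> F"
  shows "finite_dirac_sum \<mu>"
proof -
  interpret prob_space \<mu> by fact
  obtain x where x: "bij_betw x {1..card F} F"
    using ex_bij_betw_nat_finite_1[OF F(1)] by blast
  have FB: "A \<in> sets mborel" if "A \<subseteq> F" for A
    using that F by (meson finite_mborel finite_subset order_trans)
  have "emeasure \<mu> E =
      (\<Sum>j=1..card F. ennreal (measure \<mu> {x j}) * emeasure (return mborel (x j)) E)"
    if E: "E \<in> sets mborel" for E
  proof -
    have "emeasure \<mu> E = emeasure \<mu> (E \<inter> F)"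
      using AE E FB sets by (intro emeasure_eq_AE) (auto elim!: eventually_mono)
    also have "\<dots> = (\<Sum>y\<in>E \<inter> F. emeasure \<mu> {y})"
      using F FB sets by (intro emeasure_eq_sum_singleton) auto
    also have "\<dots> = (\<Sum>y\<in>F. emeasure \<mu> {y} * indicator E y)"
      using F(1) by (intro sum.mono_neutral_cong_left) (auto simp: indicator_def)
    also have "\<dots> = (\<Sum>j=1..card F. emeasure \<mu> {x j} * indicator E (x j))"
      by (rule sum.reindex_bij_betw[OF x, symmetric])
    also have "\<dots> = (\<Sum>j=1..card F. ennreal (measure \<mu> {x j}) * emeasure (return mborel (x j)) E)"
      using E by (simp add: emeasure_eq_measure)
    finally show ?thesis .
  qed
  moreover have "inj_on x {1..card F}" "x ` {1..card F} \<subseteq> M"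
    using x F by (auto simp: bij_betw_def)
  ultimately show ?thesis
    unfolding finite_dirac_sum_def using assms(1,2)
    by (intro conjI exI[of _ "card F"] exI[of _ "\<lambda>j. measure \<mu> {x j}"] exI[of _ x]) auto
qed

end

section \<open>The quotient metric\<close>

context Metric_space
begin

lemma mcomplete_if_proper:
  assumes "\<And>x r. x \<in> M \<Longrightarrow> compactin mtopology (mcball x r)"
  shows mcomplete
  unfolding mcomplete_def
proof (intro allI impI)
  fix \<sigma> :: "nat \<Rightarrow> 'a" assume \<sigma>: "MCauchy \<sigma>"
  then obtain x r where sub: "range \<sigma> \<subseteq> mcball x r"
    using MCauchy_imp_mbounded unfolding mbounded_def by blast
  then have "\<sigma> 0 \<in> mcball x r" by blast
  then have "compactin mtopology (mcball x r)" using assms by simp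
  then obtain l k where "strict_mono k" "limitin mtopology (\<sigma> \<circ> k) l sequentially"
    using sub unfolding compactin_sequentially by blast
  then show "\<exists>l. limitin mtopology \<sigma> l sequentially"
    using MCauchy_convergent_subsequence \<sigma> by blast
qed

end

locale free_isometric_action = metric_measure_space M d m
  for M :: "'a set" and d :: "'a \<Rightarrow> 'a \<Rightarrow> real" and m :: "'a measure" +
  fixes G :: "('g, 'b) monoid_scheme" and \<phi> :: "'g \<Rightarrow> 'a \<Rightarrow> 'a"
  assumes acts: "acts_by_mm_isometries G (discrete_topology (carrier G)) \<phi>"
    and free: "acts_freely G M \<phi>"
begin

abbreviation "q \<equiv> orbit G \<phi>"
abbreviation "Mq \<equiv> orbits G M \<phi>"
abbreviation "dq \<equiv> quotient_dist G \<phi> M d"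

sublocale act: group_action G M \<phi>
  using acts by (simp add: acts_by_mm_isometries_def)

lemma group_G: "group G"
  using act.group_hom group_hom.axioms(1) by auto

lemma act_in_M [simp]: "g \<in> carrier G \<Longrightarrow> x \<in> M \<Longrightarrow> \<phi> g x \<in> M"
  using act.element_image by blast

lemma act_isometry: "g \<in> carrier G \<Longrightarrow> x \<in> M \<Longrightarrow> y \<in> M \<Longrightarrow> d (\<phi> g x) (\<phi> g y) = d x y"
  using acts by (simp add: acts_by_mm_isometries_def)

lemma continuous_map_act:
  assumes "g \<in> carrier G"
  shows "continuous_map mtopology mtopology (\<phi> g)"
proof -
  have "Lipschitz_continuous_map (metric (M, d)) (metric (M, d)) (\<phi> g)"
    using assms unfolding Lipschitz_continuous_map_def
    by (auto simp: act_isometry intro!: exI[of _ 1])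
  then show ?thesis using Lipschitz_continuous_imp_continuous_map by fastforce
qed

lemma one_in_G: "\<one>\<^bsub>G\<^esub> \<in> carrier G"
  using group_G by (simp add: group.is_monoid)

lemma inv_in_G: "g \<in> carrier G \<Longrightarrow> inv\<^bsub>G\<^esub> g \<in> carrier G"
  using group_G by (simp add: group.inv_closed)

lemma act_one: "x \<in> M \<Longrightarrow> \<phi> \<one>\<^bsub>G\<^esub> x = x"
  using act.id_eq_one by (metis restrict_apply')

lemma act_inv: "g \<in> carrier G \<Longrightarrow> x \<in> M \<Longrightarrow> \<phi> (inv\<^bsub>G\<^esub> g) (\<phi> g x) = x"
  using act.orbit_sym_aux by blast

lemma act_inv': "g \<in> carrier G \<Longrightarrow> x \<in> M \<Longrightarrow> \<phi> g (\<phi> (inv\<^bsub>G\<^esub> g) x) = x"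
  using act.orbit_sym_aux[of "inv\<^bsub>G\<^esub> g" x] group_G by (simp add: group.inv_closed group.inv_inv)

lemma q_in_Mq [simp]: "x \<in> M \<Longrightarrow> q x \<in> Mq"
  by (auto simp: orbits_def)

lemma MqE:
  assumes "X \<in> Mq"
  obtains x where "x \<in> M" "X = q x"
  using assms by (auto simp: orbits_def)

lemma Mq_eq_image: "Mq = q ` M"
  by (auto simp: orbits_def)

lemma q_eq_iff:
  assumes "x \<in> M" "y \<in> M"
  shows "q x = q y \<longleftrightarrow> (\<exists>g\<in>carrier G. \<phi> g x = y)"
proof
  assume "q x = q y"
  then have "y \<in> q x" using act.orbit_refl assms by simp
  then show "\<exists>g\<in>carrier G. \<phi> g x = y" by (auto simp: orbit_def)
next
  assume "\<exists>g\<in>carrier G. \<phi> g x = y"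
  then have "y \<in> q x" by (auto simp: orbit_def)
  then have "q x \<inter> q y \<noteq> {}" using assms act.orbit_refl by blast
  then show "q x = q y" using act.disjoint_union assms q_in_Mq by blast
qed

lemma q_act [simp]: "g \<in> carrier G \<Longrightarrow> x \<in> M \<Longrightarrow> q (\<phi> g x) = q x"
  using q_eq_iff[of x "\<phi> g x"] by auto

lemma in_orbit:
  assumes "x \<in> M" "y \<in> q x"
  shows "y \<in> M" "q y = q x"
proof -
  obtain g where "g \<in> carrier G" "y = \<phi> g x" using assms by (auto simp: orbit_def)
  then show "y \<in> M" "q y = q x" using assms(1) by simp_all
qed

lemma act_free:
  assumes "g \<in> carrier G" "h \<in> carrier G" "x \<in> M" "\<phi> g x = \<phi> h x"
  shows "g = h"
proof -
  interpret group G by (rule group_G)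
  have "\<phi> (inv\<^bsub>G\<^esub> h \<otimes>\<^bsub>G\<^esub> g) x = x"
    using assms by (simp add: act.composition_rule act_inv)
  then have "inv\<^bsub>G\<^esub> h \<otimes>\<^bsub>G\<^esub> g = \<one>\<^bsub>G\<^esub>"
    using free assms unfolding acts_freely_def by (meson inv_closed m_closed)
  then show ?thesis
    using assms by (metis inv_closed inv_equality inv_inv)
qed

text \<open>Preimages of compact sets under the proper map \<open>(g, x) \<mapsto> (gx, x)\<close> are compact, and their
  projections to the discrete group are finite.\<close>

lemma finite_return:
  assumes x: "x \<in> M"
  shows "finite {g \<in> carrier G. d x (\<phi> g x) \<le> r}"
proof -
  let ?T = "discrete_topology (carrier G)" and ?K = "mcball x r"
  let ?f = "\<lambda>(g, x). (\<phi> g x, x)"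
  let ?P = "{z \<in> topspace (prod_topology ?T mtopology). ?f z \<in> ?K \<times> ?K}"
  have "proper_map (prod_topology ?T mtopology) (prod_topology mtopology mtopology) ?f"
    using acts by (simp add: acts_by_mm_isometries_def)
  moreover have "compactin (prod_topology mtopology mtopology) (?K \<times> ?K)"
    using proper[OF x] by (simp add: compactin_Times)
  ultimately have "compactin (prod_topology ?T mtopology) ?P"
    by (rule compactin_proper_map_preimage)
  then have "compactin ?T (fst ` ?P)"
    using continuous_map_fst by (rule image_compactin)
  then have "finite (fst ` ?P)" by (simp add: compactin_discrete_topology)
  moreover have "{g \<in> carrier G. d x (\<phi> g x) \<le> r} \<subseteq> fst ` ?P"
  proof
    fix g assume "g \<in> {g \<in> carrier G. d x (\<phi> g x) \<le> r}"
    moreover from this have "0 \<le> r" 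
      by (metis (no_types, lifting) mem_Collect_eq nonneg order_trans)
    ultimately have "(g, x) \<in> ?P" using x by auto
    then show "g \<in> fst ` ?P" by force
  qed
  ultimately show ?thesis by (rule finite_subset[rotated])
qed

lemma countable_G: "M \<noteq> {} \<Longrightarrow> countable (carrier G)"
proof -
  assume "M \<noteq> {}"
  then obtain x where x: "x \<in> M" by blast
  have "carrier G \<subseteq> (\<Union>n::nat. {g \<in> carrier G. d x (\<phi> g x) \<le> real n})"
    by (auto intro: real_arch_simple)
  moreover have "countable (\<Union>n::nat. {g \<in> carrier G. d x (\<phi> g x) \<le> real n})"
    by (rule countable_UN) (simp_all add: countable_finite finite_return[OF x])
  ultimately show ?thesis by (rule countable_subset)
qed

lemma dist_to_orbit_attained:
  assumes x: "x \<in> M" and y: "y \<in> M"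
  shows "\<exists>y'\<in>q y. \<forall>y''\<in>q y. d x y' \<le> d x y''"
proof -
  let ?F = "{g \<in> carrier G. d x (\<phi> g y) \<le> d x y}"
  have "d y (\<phi> g y) \<le> 2 * d x y" if "g \<in> ?F" for g
    using that triangle[of y x "\<phi> g y"] x y by (auto simp: commute)
  then have "?F \<subseteq> {g \<in> carrier G. d y (\<phi> g y) \<le> 2 * d x y}" by auto
  then have fin: "finite ?F" using finite_return[OF y] finite_subset by blast
  have "\<one>\<^bsub>G\<^esub> \<in> ?F" using one_in_G act_one y by simp
  then have "?F \<noteq> {}" by blast
  then obtain g where g: "g \<in> ?F" "\<forall>h\<in>?F. d x (\<phi> g y) \<le> d x (\<phi> h y)"
    using ex_min_if_finite[of "(\<lambda>g. d x (\<phi> g y)) ` ?F"] fin by (auto simp: not_less)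
  have "d x (\<phi> g y) \<le> d x (\<phi> h y)" if "h \<in> carrier G" for h
    using g that by (cases "h \<in> ?F") auto
  then show ?thesis
    using g by (intro bexI[of _ "\<phi> g y"]) (auto simp: orbit_def)
qed

text \<open>The definition measures from chosen representatives. Since the action is isometric, moving the
  representative of the first orbit to \<open>x\<close> does not change the set of distances to the second one.\<close>

lemma dq_eq_dist:
  assumes x: "x \<in> M" and y: "y \<in> M"
  shows "\<exists>y'\<in>M. q y' = q y \<and> dq (q x) (q y) = d x y' \<and> (\<forall>y''\<in>q y. d x y' \<le> d x y'')"
proof -
  obtain y' where y': "y' \<in> q y" "\<forall>y''\<in>q y. d x y' \<le> d x y''"
    using dist_to_orbit_attained[OF x y] by blast
  define x0 where "x0 = (SOME x'. x' \<in> q x)"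
  define y0 where "y0 = (SOME y'. y' \<in> q y)"
  have x0: "x0 \<in> q x" "x0 \<in> M" and y0: "y0 \<in> q y" "y0 \<in> M"
    using someI[of "\<lambda>x'. x' \<in> q x", OF act.orbit_refl[OF x]]
      someI[of "\<lambda>y'. y' \<in> q y", OF act.orbit_refl[OF y]] in_orbit(1) x y
    unfolding x0_def y0_def by blast+
  obtain g0 where g0: "g0 \<in> carrier G" "\<phi> g0 x0 = x"
    using x0 x in_orbit q_eq_iff by metis
  have "dq (q x) (q y) = (INF g\<in>carrier G. d (\<phi> g x0) y0)"
    using x y by (simp add: quotient_dist_def x0_def y0_def)
  also have "\<dots> = d x y'"
  proof (rule cInf_eq_minimum)
    obtain h where h: "h \<in> carrier G" "\<phi> h y' = y0"
      using y' y y0 in_orbit q_eq_iff by metis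
    have "\<phi> (h \<otimes>\<^bsub>G\<^esub> g0) x0 = \<phi> h x"
      using g0 h x0 by (simp add: act.composition_rule)
    then have "d (\<phi> (h \<otimes>\<^bsub>G\<^esub> g0) x0) y0 = d x y'"
      using h act_isometry[OF h(1) x in_orbit(1)[OF y y'(1)]] by simp
    moreover have "h \<otimes>\<^bsub>G\<^esub> g0 \<in> carrier G"
      using h g0 group_G by (simp add: group.is_monoid monoid.m_closed)
    ultimately show "d x y' \<in> (\<lambda>g. d (\<phi> g x0) y0) ` carrier G"
      by (metis image_eqI)
  next
    fix r assume "r \<in> (\<lambda>g. d (\<phi> g x0) y0) ` carrier G"
    then obtain g where g: "g \<in> carrier G" "r = d (\<phi> g x0) y0" by blast
    then have "q (\<phi> g x0) = q x" "\<phi> g x0 \<in> M"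
      using x0 in_orbit(2)[OF x x0(1)] by simp_all
    then obtain k where k: "k \<in> carrier G" "\<phi> k (\<phi> g x0) = x"
      using x q_eq_iff by metis
    then have "r = d x (\<phi> k y0)"
      using g act_isometry[of k "\<phi> g x0" y0] \<open>\<phi> g x0 \<in> M\<close> y0 by simp
    moreover have "\<phi> k y0 \<in> q y"
      using k y0 y by (metis act.orbit_refl act_in_M in_orbit(2) q_act)
    ultimately show "d x y' \<le> r" using y' by simp
  qed
  finally show ?thesis using y' in_orbit y by metis
qed

lemma dq_le: "x \<in> M \<Longrightarrow> y \<in> M \<Longrightarrow> dq (q x) (q y) \<le> d x y"
  using dq_eq_dist[of x y] act.orbit_refl[of y] by auto

lemma dq_attained:
  assumes "x \<in> M" "Y \<in> Mq"
  obtains y where "y \<in> M" "q y = Y" "d x y = dq (q x) Y"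
  using assms dq_eq_dist[of x] by (metis MqE)

sublocale Q: Metric_space Mq dq
proof
  have commute_le: "dq Y X \<le> dq X Y" if XY: "X \<in> Mq" "Y \<in> Mq" for X Y
  proof -
    obtain x where x: "x \<in> M" "X = q x" using XY MqE by blast
    obtain y where y: "y \<in> M" "q y = Y" "d x y = dq (q x) Y"
      using dq_attained[OF x(1) XY(2)] by blast
    then show ?thesis using dq_le[OF y(1) x(1)] x by (simp add: commute)
  qed
  fix X Y Z
  show "0 \<le> dq X Y"
  proof (cases "X \<in> Mq \<and> Y \<in> Mq")
    case True
    then obtain x where x: "x \<in> M" "X = q x" using MqE by blast
    with True show ?thesis by (metis dq_attained nonneg)
  qed (auto simp: quotient_dist_def)
  show "dq X Y = dq Y X"
  proof (cases "X \<in> Mq \<and> Y \<in> Mq")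
    case True
    then show ?thesis using commute_le by (meson antisym)
  qed (auto simp: quotient_dist_def)
  assume X: "X \<in> Mq" and Y: "Y \<in> Mq"
  obtain x where x: "x \<in> M" "X = q x" using X MqE by blast
  obtain y where y: "y \<in> M" "q y = Y" "d x y = dq (q x) Y"
    using dq_attained[OF x(1) Y] by blast
  show "dq X Y = 0 \<longleftrightarrow> X = Y"
  proof
    assume "dq X Y = 0"
    then show "X = Y" using x y by simp
  next
    assume "X = Y"
    moreover have "0 \<le> dq X Y" using x y nonneg by metis
    ultimately show "dq X Y = 0" using x dq_le[of x x] by simp
  qed
  assume Z: "Z \<in> Mq"
  obtain z where z: "z \<in> M" "q z = Z" "d y z = dq (q y) Z"
    using dq_attained[OF y(1) Z] by blast
  show "dq X Z \<le> dq X Y + dq Y Z"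
    using dq_le[OF x(1) z(1)] triangle[OF x(1) y(1) z(1)] x y z by simp
qed

lemma q_mball: "x \<in> M \<Longrightarrow> q ` mball x r = Q.mball (q x) r"
proof (safe, goal_cases)
  case (1 _ y) then show ?case using dq_le[of x y] by auto
next
  case (2 Y)
  then obtain y where "y \<in> M" "q y = Y" "d x y = dq (q x) Y" using dq_attained[of x Y] by auto
  then show ?case using 2 by auto
qed

lemma q_mcball: "x \<in> M \<Longrightarrow> q ` mcball x r = Q.mcball (q x) r"
proof (safe, goal_cases)
  case (1 _ y) then show ?case using dq_le[of x y] by auto
next
  case (2 Y)
  then obtain y where "y \<in> M" "q y = Y" "d x y = dq (q x) Y" using dq_attained[of x Y] by auto
  then show ?case using 2 by auto
qed

lemma continuous_map_q: "continuous_map mtopology Q.mtopology q"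
proof -
  have "Lipschitz_continuous_map (metric (M, d)) (metric (Mq, dq)) q"
    unfolding Lipschitz_continuous_map_def by (auto intro!: exI[of _ 1] dq_le)
  then show ?thesis using Lipschitz_continuous_imp_continuous_map by fastforce
qed

lemma measurable_q [measurable]: "q \<in> mborel \<rightarrow>\<^sub>M Q.mborel"
  unfolding mborel_def Q.mborel_def by (intro measurable_continuous_map continuous_map_q)

lemma open_map_q:
  assumes "openin mtopology U"
  shows "openin Q.mtopology (q ` U)"
  unfolding Q.openin_mtopology
proof (intro conjI allI impI)
  have "U \<subseteq> M" using assms openin_subset by fastforce
  then show "q ` U \<subseteq> Mq" by auto
  fix X assume "X \<in> q ` U"
  then obtain x where x: "x \<in> U" "X = q x" by blast
  then obtain r where "r > 0" "mball x r \<subseteq> U" using assms openin_mtopology[of U] by blast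
  then show "\<exists>r>0. Q.mball X r \<subseteq> q ` U"
    using x \<open>U \<subseteq> M\<close> q_mball[of x r] by (metis image_mono subsetD)
qed

text \<open>Only finitely many group elements move some point of a given ball by at most \<open>1\<close>, and by
  freeness and compactness each of them moves all points of the ball by a definite amount.\<close>

lemma displacement_bounded_below:
  assumes x: "x \<in> M"
  shows "\<exists>e>0. \<forall>y\<in>mcball x r. \<forall>g\<in>carrier G. g \<noteq> \<one>\<^bsub>G\<^esub> \<longrightarrow> e \<le> d y (\<phi> g y)"
proof -
  define F where "F = {g \<in> carrier G. d x (\<phi> g x) \<le> 2 * r + 1} - {\<one>\<^bsub>G\<^esub>}"
  have fin: "finite F" unfolding F_def using finite_return[OF x] by simp
  have "\<exists>e>0. \<forall>y\<in>mcball x r. e \<le> d y (\<phi> g y)" if g: "g \<in> F" for g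
  proof (cases "mcball x r = {}")
    case False
    have gG: "g \<in> carrier G" "g \<noteq> \<one>\<^bsub>G\<^esub>" using g by (auto simp: F_def)
    have "continuous_map mtopology mtopology (\<phi> g)" using gG(1) by (rule continuous_map_act)
    then have "continuous_map mtopology euclidean (\<lambda>y. d y (\<phi> g y))"
      using continuous_map_mdist[of mtopology "metric (M, d)" "\<lambda>y. y" "\<phi> g"] by simp
    then have "compactin euclidean ((\<lambda>y. d y (\<phi> g y)) ` mcball x r)"
      using proper[OF x] image_compactin by blast
    then have "compact ((\<lambda>y. d y (\<phi> g y)) ` mcball x r)" by simp
    then obtain y where y: "y \<in> mcball x r" "\<forall>z\<in>mcball x r. d y (\<phi> g y) \<le> d z (\<phi> g z)"
      using compact_attains_inf[of "(\<lambda>y. d y (\<phi> g y)) ` mcball x r"] False by blast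
    have "\<phi> g y \<noteq> y" using y gG free by (auto simp: acts_freely_def)
    then have "0 < d y (\<phi> g y)" using y gG by (intro mdist_pos_less) auto
    then show ?thesis using y by blast
  qed (auto intro: exI[of _ 1])
  then obtain e where e: "\<And>g. g \<in> F \<Longrightarrow> e g > 0"
    "\<And>g y. g \<in> F \<Longrightarrow> y \<in> mcball x r \<Longrightarrow> e g \<le> d y (\<phi> g y)"
    by metis
  define e0 where "e0 = Min (insert 1 (e ` F))"
  have "e0 > 0" unfolding e0_def using fin e by simp
  moreover have "e0 \<le> d y (\<phi> g y)"
    if y: "y \<in> mcball x r" and g: "g \<in> carrier G" "g \<noteq> \<one>\<^bsub>G\<^esub>" for y g
  proof (cases "g \<in> F")
    case True
    then have "e0 \<le> e g" unfolding e0_def using fin by simp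
    with e True y show ?thesis by force
  next
    case False
    then have "2 * r + 1 < d x (\<phi> g x)" using g by (auto simp: F_def)
    also have "\<dots> \<le> d x y + d y (\<phi> g y) + d (\<phi> g y) (\<phi> g x)"
      using triangle[of x y "\<phi> g x"] triangle[of y "\<phi> g y" "\<phi> g x"] x y g by simp
    also have "\<dots> \<le> 2 * r + d y (\<phi> g y)"
      using y x g by (simp add: act_isometry commute)
    finally have "1 \<le> d y (\<phi> g y)" by simp
    moreover have "e0 \<le> 1" unfolding e0_def using fin by simp
    ultimately show ?thesis by simp
  qed
  ultimately show ?thesis by blast
qed

text \<open>If the nearest point of the orbit of \<open>z\<close> were \<open>g z\<close> with \<open>g\<close> nontrivial, then \<open>g\<close> would move \<open>y\<close> by at
  most \<open>d y (g z) + d (g z) (g y) \<le> 2 * d y z\<close>.\<close>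

lemma dq_eq_d_if_close:
  assumes x: "x \<in> M"
  shows "\<exists>e>0. \<forall>y\<in>mcball x r. \<forall>z\<in>M. d y z < e \<longrightarrow> dq (q y) (q z) = d y z"
proof -
  obtain e where e: "e > 0"
    "\<And>y g. y \<in> mcball x r \<Longrightarrow> g \<in> carrier G \<Longrightarrow> g \<noteq> \<one>\<^bsub>G\<^esub> \<Longrightarrow> e \<le> d y (\<phi> g y)"
    using displacement_bounded_below[OF x] by blast
  have "dq (q y) (q z) = d y z" if y: "y \<in> mcball x r" and z: "z \<in> M" "d y z < e / 2" for y z
  proof -
    have yM: "y \<in> M" using y by simp
    obtain z' where z': "z' \<in> M" "q z' = q z" "d y z' = dq (q y) (q z)"
      using dq_attained[OF yM, of "q z"] z by auto
    then obtain g where g: "g \<in> carrier G" "\<phi> g z = z'"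
      using q_eq_iff z by metis
    show ?thesis
    proof (cases "g = \<one>\<^bsub>G\<^esub>")
      case True
      then have "z' = z" using g z act_one by simp
      then show ?thesis using z' by simp
    next
      case False
      have "e \<le> d y (\<phi> g y)" using e y g False by blast
      also have "\<dots> \<le> d y z' + d z' (\<phi> g y)"
        using triangle[of y z' "\<phi> g y"] yM z' g by simp
      also have "d z' (\<phi> g y) = d z y" using g yM z act_isometry by auto
      finally have "d y z < dq (q y) (q z)" using z z' by (simp add: commute)
      then show ?thesis using dq_le[OF yM z(1)] by simp
    qed
  qed
  then show ?thesis using half_gt_zero[OF e(1)] by blast
qed

definition isometric_on :: "'a set \<Rightarrow> bool" where
  "isometric_on U \<longleftrightarrow> (\<forall>y\<in>U. \<forall>z\<in>U. dq (q y) (q z) = d y z)"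

lemma isometric_on_subset: "isometric_on U \<Longrightarrow> V \<subseteq> U \<Longrightarrow> isometric_on V"
  unfolding isometric_on_def by blast

lemma isometric_on_inj:
  assumes "isometric_on U" "U \<subseteq> M"
  shows "inj_on q U"
proof (rule inj_onI)
  fix y z assume yz: "y \<in> U" "z \<in> U" "q y = q z"
  then have M: "y \<in> M" "z \<in> M" using assms(2) by blast+
  have "d y z = dq (q y) (q z)" using assms(1) yz(1,2) unfolding isometric_on_def by metis
  also have "\<dots> = 0" using yz(3) M by simp
  finally show "y = z" using M by simp
qed

lemma isometric_ball:
  assumes x: "x \<in> M"
  shows "\<exists>r>0. isometric_on (mball x r)"
proof -
  obtain e where e: "e > 0"
    "\<And>y z. y \<in> mcball x 1 \<Longrightarrow> z \<in> M \<Longrightarrow> d y z < e \<Longrightarrow> dq (q y) (q z) = d y z"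
    using dq_eq_d_if_close[OF x] by blast
  define r where "r = min 1 (e / 2)"
  have "dq (q y) (q z) = d y z" if "y \<in> mball x r" "z \<in> mball x r" for y z
    using that x triangle[of y x z] by (intro e(2)) (auto simp: r_def commute)
  moreover have "r > 0" using e(1) by (simp add: r_def)
  ultimately show ?thesis unfolding isometric_on_def by blast
qed

section \<open>The quotient is a complete, separable, proper, geodesic space\<close>

lemma Q_proper:
  assumes "X \<in> Mq"
  shows "compactin Q.mtopology (Q.mcball X r)"
proof -
  obtain x where "x \<in> M" "X = q x" using assms MqE by blast
  then show ?thesis
    using image_compactin[OF proper[of x r] continuous_map_q] by (simp add: q_mcball)
qed

lemma Q_separable: "separable_space Q.mtopology"
proof -
  have "separable_space (subtopology Q.mtopology (q ` topspace mtopology))"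
    by (rule separable_space_continuous_map_image[OF separable])
       (use continuous_map_q in \<open>auto simp: continuous_map_in_subtopology\<close>)
  then show ?thesis by (simp flip: Mq_eq_image)
qed

text \<open>Projecting shortens no part of a curve that realises the distance of two orbits: a shortened
  part would, by the triangle inequality, bring the two orbits closer together.\<close>

lemma Geo_q:
  assumes \<gamma>: "\<gamma> \<in> Geo" and eq: "dq (q (\<gamma> 0)) (q (\<gamma> 1)) = d (\<gamma> 0) (\<gamma> 1)"
  shows "(\<lambda>t\<in>{0..1}. q (\<gamma> t)) \<in> Q.Geo"
proof -
  let ?l = "d (\<gamma> 0) (\<gamma> 1)"
  have le: "dq (q (\<gamma> s)) (q (\<gamma> t)) \<le> \<bar>s - t\<bar> * ?l" if "s \<in> {0..1}" "t \<in> {0..1}" for s t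
    using dq_le[of "\<gamma> s" "\<gamma> t"] Geo_in_M[OF \<gamma>] Geo_dist[OF \<gamma> that] that by simp
  have *: "dq (q (\<gamma> s)) (q (\<gamma> t)) = (t - s) * ?l" if st: "0 \<le> s" "s \<le> t" "t \<le> 1" for s t
  proof -
    have M: "q (\<gamma> s) \<in> Mq" "q (\<gamma> t) \<in> Mq" "q (\<gamma> 0) \<in> Mq" "q (\<gamma> 1) \<in> Mq"
      using st \<gamma> Geo_in_M by auto
    have "?l \<le> dq (q (\<gamma> 0)) (q (\<gamma> s)) + dq (q (\<gamma> s)) (q (\<gamma> t)) + dq (q (\<gamma> t)) (q (\<gamma> 1))"
      using Q.triangle[OF M(3) M(1) M(4)] Q.triangle[OF M(1) M(2) M(4)] eq by simp
    also have "\<dots> \<le> s * ?l + dq (q (\<gamma> s)) (q (\<gamma> t)) + (1 - t) * ?l"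
      using le[of 0 s] le[of t 1] st by simp
    finally have "(t - s) * ?l \<le> dq (q (\<gamma> s)) (q (\<gamma> t))"
      by (simp add: algebra_simps)
    then show ?thesis using le[of s t] st by simp
  qed
  have "dq (q (\<gamma> s)) (q (\<gamma> t)) = \<bar>s - t\<bar> * ?l" if "s \<in> {0..1}" "t \<in> {0..1}" for s t
    using that *[of s t] *[of t s] by (cases "s \<le> t") (auto simp: Q.commute)
  then show ?thesis
    using Geo_in_M[OF \<gamma>] eq unfolding Q.Geo_iff by simp
qed

lemma Q_geodesic:
  assumes "X \<in> Mq" "Y \<in> Mq"
  shows "\<exists>\<gamma>\<in>Q.Geo. \<gamma> 0 = X \<and> \<gamma> 1 = Y"
proof -
  obtain x where x: "x \<in> M" "X = q x" using assms MqE by blast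
  obtain y where y: "y \<in> M" "q y = Y" "d x y = dq (q x) Y"
    using dq_attained[OF x(1) assms(2)] by blast
  obtain \<gamma> where "\<gamma> \<in> Geo" "\<gamma> 0 = x" "\<gamma> 1 = y" using geodesic x y by blast
  then show ?thesis
    using x y Geo_q[of \<gamma>] by (intro bexI[of _ "\<lambda>t\<in>{0..1}. q (\<gamma> t)"]) auto
qed

end

section \<open>The quotient measure\<close>

context free_isometric_action
begin

lemma sets_m [measurable_cong]: "sets m = sets mborel"
  by (rule borel)

lemma space_m [simp]: "space m = M"
  using sets_eq_imp_space_eq[OF borel] by simp

lemma exists_sheets:
  "\<exists>B :: nat \<Rightarrow> 'a set. (\<forall>n. openin mtopology (B n) \<and> isometric_on (B n) \<and> mbounded (B n)) \<and>
    (\<Union>n. B n) = M"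
proof -
  let ?P = "\<lambda>U. openin mtopology U \<and> isometric_on U \<and> mbounded U"
  have "\<exists>U. ?P U \<and> x \<in> U" if "x \<in> M" for x
    using isometric_ball[OF that] that by (metis centre_in_mball_iff mbounded_mball openin_mball)
  moreover have "U \<subseteq> M" if "openin mtopology U" for U
    using openin_subset[OF that] by simp
  ultimately have "\<Union>{U. ?P U} = topspace mtopology" by auto
  moreover have "Lindelof_space mtopology"
    using second_countable_mtopology[OF separable] by (rule second_countable_imp_Lindelof_space)
  ultimately obtain V where V: "countable V" "V \<subseteq> {U. ?P U}" "\<Union>V = M"
    using Lindelof_spaceD[of mtopology "{U. ?P U}"] by auto
  let ?V = "insert {} V"
  have range: "range (from_nat_into ?V) = ?V"
    using V(1) by (intro range_from_nat_into) auto
  have "\<forall>U\<in>?V. ?P U" using V(2) by (auto simp: isometric_on_def)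
  moreover have "from_nat_into ?V n \<in> ?V" for n using range by blast
  ultimately have "\<forall>n. ?P (from_nat_into ?V n)" by blast
  moreover have "(\<Union>n. from_nat_into ?V n) = M" unfolding range using V(3) by simp
  ultimately show ?thesis by blast
qed

text \<open>Boundedness of the sheets ensures that the section below is bounded on compact sets.\<close>

definition sheet :: "nat \<Rightarrow> 'a set" where
  "sheet = (SOME B. (\<forall>n. openin mtopology (B n) \<and> isometric_on (B n) \<and> mbounded (B n)) \<and>
    (\<Union>n. B n) = M)"

lemma sheet:
  "openin mtopology (sheet n)" "isometric_on (sheet n)" "mbounded (sheet n)" "(\<Union>n. sheet n) = M"
  using someI_ex[OF exists_sheets] unfolding sheet_def by blast+

lemma sheet_subset: "sheet n \<subseteq> M"
  using sheet(4) by blast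

lemma inj_on_sheet: "inj_on q (sheet n)"
  using sheet(2) sheet_subset by (rule isometric_on_inj)

definition sheet_index :: "'a set \<Rightarrow> nat" where
  "sheet_index X = (LEAST n. X \<in> q ` sheet n)"

text \<open>The section chooses representatives in the first sheet that meets the orbit.\<close>

definition sect :: "'a set \<Rightarrow> 'a" where
  "sect X = the_inv_into (sheet (sheet_index X)) q X"

definition piece :: "nat \<Rightarrow> 'a set set" where
  "piece n = {X \<in> Mq. sheet_index X = n}"

lemma sheet_index: "X \<in> Mq \<Longrightarrow> X \<in> q ` sheet (sheet_index X)"
proof -
  assume "X \<in> Mq"
  then have "\<exists>n. X \<in> q ` sheet n" using sheet(4) by (fastforce simp: Mq_eq_image)
  then show ?thesis unfolding sheet_index_def by (rule LeastI_ex)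
qed

lemma sect:
  assumes "X \<in> Mq"
  shows "sect X \<in> sheet (sheet_index X)" "q (sect X) = X" "sect X \<in> M"
proof -
  show "sect X \<in> sheet (sheet_index X)"
    unfolding sect_def using the_inv_into_into[OF inj_on_sheet sheet_index[OF assms]] by blast
  then show "sect X \<in> M" using sheet_subset by blast
  show "q (sect X) = X"
    unfolding sect_def by (rule f_the_inv_into_f[OF inj_on_sheet sheet_index[OF assms]])
qed

lemma sect_eq: "X \<in> piece n \<Longrightarrow> x \<in> sheet n \<Longrightarrow> q x = X \<Longrightarrow> sect X = x"
  using sect[of X] inj_onD[OF inj_on_sheet[of n], of "sect X" x] by (simp add: piece_def)

lemma openin_q_sheet: "openin Q.mtopology (q ` sheet n)"
  by (intro open_map_q sheet)

lemma piece_measurable [measurable]: "piece n \<in> sets Q.mborel"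
proof -
  have "piece n = q ` sheet n - (\<Union>k<n. q ` sheet k)"
  proof (intro equalityI subsetI)
    fix X assume "X \<in> piece n"
    then have X: "X \<in> Mq" "n = sheet_index X" by (simp_all add: piece_def)
    then have "X \<notin> q ` sheet k" if "k < n" for k
      using that not_less_Least[of k "\<lambda>n. X \<in> q ` sheet n"] unfolding sheet_index_def by blast
    then show "X \<in> q ` sheet n - (\<Union>k<n. q ` sheet k)"
      using sheet_index[OF X(1)] X(2) by blast
  next
    fix X assume X: "X \<in> q ` sheet n - (\<Union>k<n. q ` sheet k)"
    then have "sheet_index X = n" unfolding sheet_index_def
      by (intro Least_equality) (auto simp: not_less[symmetric])
    moreover have "X \<in> Mq" using X sheet_subset[of n] q_in_Mq by blast
    ultimately show "X \<in> piece n" by (simp add: piece_def)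
  qed
  then show ?thesis
    using Q.openin_mborel[OF openin_q_sheet] by auto
qed

lemma UN_piece: "(\<Union>n. piece n) = Mq" and disjoint_piece: "disjoint_family piece"
  by (auto simp: piece_def disjoint_family_on_def)

lemma piece_subset: "piece n \<subseteq> q ` sheet n"
  using sheet_index by (auto simp: piece_def)

text \<open>On each piece the section is the inverse of the open map \<open>q\<close> restricted to one sheet.\<close>

lemma measurable_sect [measurable]: "sect \<in> Q.mborel \<rightarrow>\<^sub>M mborel"
  unfolding mborel_def
proof (rule measurable_borel_ofI)
  show "sect \<in> space Q.mborel \<rightarrow> topspace mtopology" using sect by auto
  fix U assume U: "openin mtopology U"
  have "sect -` U \<inter> space Q.mborel = (\<Union>n. piece n \<inter> q ` (sheet n \<inter> U))"
  proof (intro equalityI subsetI)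
    fix X assume "X \<in> sect -` U \<inter> space Q.mborel"
    then have "X \<in> Mq" "sect X \<in> U" by auto
    then have "X \<in> piece (sheet_index X)" "sect X \<in> sheet (sheet_index X) \<inter> U"
      "q (sect X) = X"
      using sect(1,2)[of X] by (simp_all add: piece_def)
    then show "X \<in> (\<Union>n. piece n \<inter> q ` (sheet n \<inter> U))"
      by (intro UN_I[of "sheet_index X"] IntI image_eqI[of X q "sect X"]) simp_all
  next
    fix X assume "X \<in> (\<Union>n. piece n \<inter> q ` (sheet n \<inter> U))"
    then obtain n x where X: "X \<in> piece n" "x \<in> sheet n" "x \<in> U" "X = q x" by blast
    have "sect X = x" using X(1,2) X(4)[symmetric] by (rule sect_eq)
    moreover have "X \<in> Mq" using X(1) by (simp add: piece_def)
    ultimately show "X \<in> sect -` U \<inter> space Q.mborel" using X(3) by simp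
  qed
  moreover have "q ` (sheet n \<inter> U) \<in> sets Q.mborel" for n
    using U sheet by (intro Q.openin_mborel open_map_q) auto
  ultimately show "sect -` U \<inter> space Q.mborel \<in> sets Q.mborel" by auto
qed

text \<open>A fundamental domain: the image of the section.\<close>

definition fund :: "'a set" where
  "fund = {x \<in> M. sect (q x) = x}"

lemma fund_measurable [measurable]: "fund \<in> sets m"
proof -
  have "fund = (\<Union>n. sheet n \<inter> (q -` piece n \<inter> space mborel))"
  proof (intro equalityI subsetI)
    fix x assume "x \<in> fund"
    then have x: "x \<in> M" "sect (q x) = x" by (auto simp: fund_def)
    then have "x \<in> sheet (sheet_index (q x))" using sect(1)[of "q x"] by simp
    then show "x \<in> (\<Union>n. sheet n \<inter> (q -` piece n \<inter> space mborel))"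
      using x by (auto simp: piece_def)
  next
    fix x assume "x \<in> (\<Union>n. sheet n \<inter> (q -` piece n \<inter> space mborel))"
    then show "x \<in> fund" using sect_eq by (auto simp: fund_def)
  qed
  also have "\<dots> \<in> sets mborel"
    using openin_mborel[OF sheet(1)] measurable_sets[OF measurable_q piece_measurable] by auto
  finally show ?thesis by (simp add: borel)
qed

lemma inj_on_fund: "inj_on q fund"
  by (rule inj_on_inverseI[of _ sect]) (simp add: fund_def)

lemma sect_in_fund: "X \<in> Mq \<Longrightarrow> sect X \<in> fund"
  using sect by (simp add: fund_def)

lemma act_image_measurable:
  assumes g: "g \<in> carrier G" and A: "A \<in> sets m"
  shows "\<phi> g ` A \<in> sets m"
proof -
  let ?h = "\<phi> (inv\<^bsub>G\<^esub> g)"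
  have AM: "A \<subseteq> M" using sets.sets_into_space[OF A] by simp
  have "continuous_map mtopology mtopology ?h" using inv_in_G[OF g] by (rule continuous_map_act)
  then have "?h \<in> mborel \<rightarrow>\<^sub>M mborel"
    unfolding mborel_def by (rule measurable_continuous_map)
  then have "?h -` A \<inter> M \<in> sets m"
    using measurable_sets[of ?h mborel mborel A] A by (simp add: borel)
  moreover have "?h -` A \<inter> M = \<phi> g ` A"
  proof (intro equalityI subsetI)
    fix x assume "x \<in> ?h -` A \<inter> M"
    then show "x \<in> \<phi> g ` A" using act_inv'[OF g, of x] by (intro image_eqI[of _ _ "?h x"]) auto
  next
    fix x assume "x \<in> \<phi> g ` A"
    then show "x \<in> ?h -` A \<inter> M" using act_inv[OF g] g AM by auto
  qed
  ultimately show ?thesis by simp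
qed

text \<open>Cut \<open>A\<close> into the countably many parts \<open>A \<inter> gB\<close>; moving each of them by the inverse of \<open>g\<close>
  yields a partition of \<open>B\<close>.\<close>

lemma emeasure_eq_if_same_orbits:
  assumes A: "A \<in> sets m" "inj_on q A" and B: "B \<in> sets m" "inj_on q B"
    and eq: "q ` A = q ` B"
  shows "emeasure m A = emeasure m B"
proof (cases "M = {}")
  case True
  then have "A = {}" "B = {}" using A B sets.sets_into_space by fastforce+
  then show ?thesis by simp
next
  case False
  have AM: "A \<subseteq> M" and BM: "B \<subseteq> M" using A B sets.sets_into_space by fastforce+
  have inter: "A \<inter> \<phi> g ` B \<in> sets m" "B \<inter> \<phi> (inv\<^bsub>G\<^esub> g) ` A \<in> sets m" if "g \<in> carrier G" for g
    using that A B act_image_measurable inv_in_G by auto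
  have A_eq: "A = (\<Union>g\<in>carrier G. A \<inter> \<phi> g ` B)"
  proof -
    have "x \<in> (\<Union>g\<in>carrier G. \<phi> g ` B)" if "x \<in> A" for x
    proof -
      have "q x \<in> q ` B" using that unfolding eq[symmetric] by (rule imageI)
      then obtain y where y: "y \<in> B" "q x = q y" by (rule imageE)
      then obtain g where "g \<in> carrier G" "\<phi> g y = x"
        using q_eq_iff[of y x] AM BM \<open>x \<in> A\<close> by (metis subsetD)
      then show ?thesis using y by blast
    qed
    then show ?thesis by auto
  qed
  have B_eq: "B = (\<Union>g\<in>carrier G. B \<inter> \<phi> (inv\<^bsub>G\<^esub> g) ` A)"
  proof -
    have "y \<in> (\<Union>g\<in>carrier G. \<phi> (inv\<^bsub>G\<^esub> g) ` A)" if "y \<in> B" for y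
    proof -
      have "q y \<in> q ` A" using that unfolding eq by (rule imageI)
      then obtain x where x: "x \<in> A" "q y = q x" by (rule imageE)
      then obtain g where g: "g \<in> carrier G" "\<phi> g y = x"
        using q_eq_iff[of y x] AM BM \<open>y \<in> B\<close> by (metis subsetD)
      then have "\<phi> (inv\<^bsub>G\<^esub> g) x = y" using act_inv BM that by auto
      then show ?thesis using g x by blast
    qed
    then show ?thesis by auto
  qed
  have move: "\<phi> g ` (B \<inter> \<phi> (inv\<^bsub>G\<^esub> g) ` A) = A \<inter> \<phi> g ` B" if g: "g \<in> carrier G" for g
  proof (intro equalityI subsetI)
    fix x assume "x \<in> \<phi> g ` (B \<inter> \<phi> (inv\<^bsub>G\<^esub> g) ` A)"
    then show "x \<in> A \<inter> \<phi> g ` B" using act_inv'[OF g] AM by auto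
  next
    fix x assume "x \<in> A \<inter> \<phi> g ` B"
    then obtain y where y: "y \<in> B" "x = \<phi> g y" "x \<in> A" by blast
    then have "y = \<phi> (inv\<^bsub>G\<^esub> g) x" using act_inv[OF g] BM by auto
    then show "x \<in> \<phi> g ` (B \<inter> \<phi> (inv\<^bsub>G\<^esub> g) ` A)" using y by blast
  qed
  have disjA: "disjoint_family_on (\<lambda>g. A \<inter> \<phi> g ` B) (carrier G)"
    unfolding disjoint_family_on_def
  proof (intro ballI impI)
    fix g h assume gh: "g \<in> carrier G" "h \<in> carrier G" "g \<noteq> h"
    have False if "y \<in> B" "z \<in> B" "\<phi> g y = \<phi> h z" for y z
    proof -
      have "q y = q z" using that gh BM by (metis q_act subsetD)
      then have "y = z" using B(2) that by (auto dest: inj_onD)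
      then show False using act_free that gh BM by blast
    qed
    then show "A \<inter> \<phi> g ` B \<inter> (A \<inter> \<phi> h ` B) = {}" by blast
  qed
  have disjB: "disjoint_family_on (\<lambda>g. B \<inter> \<phi> (inv\<^bsub>G\<^esub> g) ` A) (carrier G)"
    unfolding disjoint_family_on_def
  proof (intro ballI impI)
    fix g h assume gh: "g \<in> carrier G" "h \<in> carrier G" "g \<noteq> h"
    have False if "y \<in> A" "z \<in> A" "\<phi> (inv\<^bsub>G\<^esub> g) y = \<phi> (inv\<^bsub>G\<^esub> h) z" for y z
    proof -
      have "q y = q z" using that gh AM by (metis inv_in_G q_act subsetD)
      then have "y = z" using A(2) that by (auto dest: inj_onD)
      then have "inv\<^bsub>G\<^esub> g = inv\<^bsub>G\<^esub> h" using act_free that gh AM inv_in_G by blast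
      then show False using gh group_G by (metis group.inv_inv)
    qed
    then show "B \<inter> \<phi> (inv\<^bsub>G\<^esub> g) ` A \<inter> (B \<inter> \<phi> (inv\<^bsub>G\<^esub> h) ` A) = {}" by blast
  qed
  have "emeasure m A = (\<integral>\<^sup>+ g. emeasure m (A \<inter> \<phi> g ` B) \<partial>count_space (carrier G))"
    by (subst A_eq, rule emeasure_UN_countable) (use inter countable_G[OF False] disjA in auto)
  also have "\<dots> = (\<integral>\<^sup>+ g. emeasure m (B \<inter> \<phi> (inv\<^bsub>G\<^esub> g) ` A) \<partial>count_space (carrier G))"
    using acts inter(2) by (intro nn_integral_cong) (auto simp: acts_by_mm_isometries_def move[symmetric])
  also have "\<dots> = emeasure m B"
    by (subst (2) B_eq, rule emeasure_UN_countable[symmetric])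
      (use inter countable_G[OF False] disjB in auto)
  finally show ?thesis .
qed

abbreviation "mq \<equiv> quotient_measure G \<phi> M d m"

definition fund_measure :: "'a set measure" where
  "fund_measure = distr (restrict_space m fund) Q.mborel q"

lemma measurable_q_m: "q \<in> m \<rightarrow>\<^sub>M Q.mborel"
  by measurable

lemma q_vimage_measurable: "E \<in> sets Q.mborel \<Longrightarrow> q -` E \<inter> M \<in> sets m"
  using measurable_sets[OF measurable_q_m, of E] by simp

lemma sets_vimage_Int:
  assumes "E \<in> sets Q.mborel" "A \<in> sets m"
  shows "A \<inter> q -` E \<in> sets m"
proof -
  have "A \<inter> q -` E = A \<inter> (q -` E \<inter> M)" using sets.sets_into_space[OF assms(2)] by auto
  then show ?thesis using assms q_vimage_measurable by auto
qed

lemma sets_fund_measure [simp]: "sets fund_measure = sets Q.mborel"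
  by (simp add: fund_measure_def)

lemma emeasure_fund_measure:
  assumes E: "E \<in> sets Q.mborel"
  shows "emeasure fund_measure E = emeasure m (fund \<inter> q -` E)"
proof -
  have "emeasure fund_measure E = emeasure (restrict_space m fund) (q -` E \<inter> fund)"
    unfolding fund_measure_def using E
    by (subst emeasure_distr[OF measurable_restrict_space1[OF measurable_q_m]])
      (auto simp: space_restrict_space fund_def intro!: arg_cong2[of _ _ _ _ emeasure])
  also have "\<dots> = emeasure m (fund \<inter> q -` E)"
    using sets.Int[OF sets.top fund_measurable]
    by (subst emeasure_restrict_space) (auto simp: Int_commute)
  finally show ?thesis .
qed

text \<open>By invariance, any other Borel set of representatives may replace the fundamental domain.\<close>

lemma emeasure_fund_measure_sheet:
  assumes U: "U \<in> sets m" "inj_on q U" and E: "E \<in> sets Q.mborel" "E \<subseteq> q ` U"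
  shows "emeasure fund_measure E = emeasure m (U \<inter> q -` E)"
proof -
  have "E \<subseteq> Mq" using sets.sets_into_space[OF E(1)] by simp
  have "X \<in> q ` (fund \<inter> q -` E)" if "X \<in> E" for X
    using that sect[of X] sect_in_fund[of X] \<open>E \<subseteq> Mq\<close>
    by (intro image_eqI[of X q "sect X"]) auto
  then have "q ` (fund \<inter> q -` E) = E" by blast
  moreover have "q ` (U \<inter> q -` E) = E" using E(2) by blast
  ultimately have "emeasure m (fund \<inter> q -` E) = emeasure m (U \<inter> q -` E)"
    using U E(1) inj_on_fund
    by (intro emeasure_eq_if_same_orbits sets_vimage_Int) (auto intro: inj_on_subset)
  then show ?thesis by (simp add: emeasure_fund_measure E)
qed

text \<open>This form makes uniqueness visible: the values on subsets of the images of sheets are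
  prescribed, and every Borel set is a countable disjoint union of such subsets.\<close>

lemma is_quotient_measure_iff:
  assumes "sets \<mu> = sets Q.mborel"
  shows "is_quotient_measure G \<phi> M d m \<mu> \<longleftrightarrow>
    (\<forall>U. openin mtopology U \<and> isometric_on U \<longrightarrow>
      (\<forall>E\<in>sets Q.mborel. E \<subseteq> q ` U \<longrightarrow> emeasure \<mu> E = emeasure m (U \<inter> q -` E)))"
proof -
  have *: "restrict_space \<mu> (q ` U) = distr (restrict_space m U) (restrict_space \<mu> (q ` U)) q \<longleftrightarrow>
      (\<forall>E\<in>sets Q.mborel. E \<subseteq> q ` U \<longrightarrow> emeasure \<mu> E = emeasure m (U \<inter> q -` E))"
    if U: "openin mtopology U" for U
  proof -
    let ?L = "restrict_space \<mu> (q ` U)" and ?R = "distr (restrict_space m U) (restrict_space \<mu> (q ` U)) q"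
    have UM: "U \<subseteq> M" using openin_subset[OF U] by simp
    have Um: "U \<in> sets m" using openin_mborel[OF U] borel by simp
    have qU: "q ` U \<in> sets \<mu>" using Q.openin_mborel[OF open_map_q[OF U]] assms by simp
    have "q \<in> m \<rightarrow>\<^sub>M \<mu>" using measurable_q_m assms by (simp cong: measurable_cong_sets)
    then have q: "q \<in> restrict_space m U \<rightarrow>\<^sub>M ?L"
      by (rule measurable_restrict_space3) auto
    have sets_L: "E \<in> sets ?L \<longleftrightarrow> E \<in> sets Q.mborel \<and> E \<subseteq> q ` U" for E
      using qU assms by (subst sets_restrict_space_iff) auto
    have L: "emeasure ?L E = emeasure \<mu> E" if "E \<in> sets ?L" for E
      using that qU sets_L by (intro emeasure_restrict_space) auto
    have R: "emeasure ?R E = emeasure m (U \<inter> q -` E)" if "E \<in> sets ?L" for E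
    proof -
      have "emeasure ?R E = emeasure (restrict_space m U) (U \<inter> q -` E)"
        using that UM by (subst emeasure_distr[OF q])
          (auto simp: space_restrict_space intro!: arg_cong2[of _ _ _ _ emeasure])
      also have "\<dots> = emeasure m (U \<inter> q -` E)"
        using sets.Int[OF Um sets.top] by (intro emeasure_restrict_space) auto
      finally show ?thesis .
    qed
    have "?L = ?R \<longleftrightarrow> (\<forall>E\<in>sets ?L. emeasure ?L E = emeasure ?R E)"
      by (auto intro!: measure_eqI)
    then show ?thesis using L R sets_L by auto
  qed
  show ?thesis
    unfolding is_quotient_measure_def isometric_on_def[symmetric]
    by (simp add: assms * cong: imp_cong)
qed

lemma is_quotient_measure_unique:
  assumes "is_quotient_measure G \<phi> M d m \<mu>" "is_quotient_measure G \<phi> M d m \<mu>'"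
  shows "\<mu> = \<mu>'"
proof (rule measure_eqI)
  have s: "sets \<mu> = sets Q.mborel" "sets \<mu>' = sets Q.mborel"
    using assms by (auto simp: is_quotient_measure_def)
  then show "sets \<mu> = sets \<mu>'" by simp
  fix E assume E: "E \<in> sets \<mu>"
  have P: "E \<inter> piece n \<in> sets Q.mborel" "E \<inter> piece n \<subseteq> q ` sheet n" for n
    using E s piece_subset[of n] by auto
  have "emeasure \<nu> (E \<inter> piece n) = emeasure m (sheet n \<inter> q -` (E \<inter> piece n))"
    if "is_quotient_measure G \<phi> M d m \<nu>" "sets \<nu> = sets Q.mborel" for \<nu> n
    using that(1) sheet(1,2)[of n] P[of n] unfolding is_quotient_measure_iff[OF that(2)] by blast
  then have "emeasure \<mu> (E \<inter> piece n) = emeasure \<mu>' (E \<inter> piece n)" for n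
    using assms s by simp
  then have "(\<Sum>n. emeasure \<mu> (E \<inter> piece n)) = (\<Sum>n. emeasure \<mu>' (E \<inter> piece n))" by simp
  moreover have "disjoint_family (\<lambda>n. E \<inter> piece n)"
    using disjoint_piece by (auto simp: disjoint_family_on_def)
  ultimately have "emeasure \<mu> (\<Union>n. E \<inter> piece n) = emeasure \<mu>' (\<Union>n. E \<inter> piece n)"
    using P s by (subst (asm) (1 2) suminf_emeasure) auto
  moreover have "(\<Union>n. E \<inter> piece n) = E"
    using UN_piece E sets.sets_into_space[of E Q.mborel] s by auto
  ultimately show "emeasure \<mu> E = emeasure \<mu>' E" by simp
qed

lemma quotient_measure_eq: "mq = fund_measure"
  unfolding quotient_measure_def
proof (rule the_equality)
  have "emeasure fund_measure E = emeasure m (U \<inter> q -` E)"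
    if "openin mtopology U" "isometric_on U" "E \<in> sets Q.mborel" "E \<subseteq> q ` U" for U E
    using that openin_mborel[of U] isometric_on_inj[of U] openin_subset[of mtopology U] borel
    by (intro emeasure_fund_measure_sheet) auto
  then show "is_quotient_measure G \<phi> M d m fund_measure"
    by (simp add: is_quotient_measure_iff)
  then show "\<mu> = fund_measure" if "is_quotient_measure G \<phi> M d m \<mu>" for \<mu>
    using is_quotient_measure_unique that by blast
qed

lemma sets_mq [simp, measurable_cong]: "sets mq = sets Q.mborel"
  by (simp add: quotient_measure_eq)

lemma space_mq [simp]: "space mq = Mq"
  using sets_eq_imp_space_eq[OF sets_mq] by simp

lemmas emeasure_mq = emeasure_fund_measure[folded quotient_measure_eq]
lemmas emeasure_mq_sheet = emeasure_fund_measure_sheet[folded quotient_measure_eq]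

lemma Q_sigma_finite: "sigma_finite_measure mq"
proof -
  obtain A where A: "countable A" "A \<subseteq> sets m" "\<Union>A = M" "\<forall>a\<in>A. emeasure m a \<noteq> \<infinity>"
    using sigma_finite by (auto simp: sigma_finite_measure_def)
  let ?A = "(\<lambda>a. sect -` a \<inter> Mq) ` A"
  have "sect -` a \<inter> Mq \<in> sets mq" if "a \<in> A" for a
    using that A(2) measurable_sets[OF measurable_sect, of a] by (auto simp: borel)
  moreover have "emeasure mq (sect -` a \<inter> Mq) \<noteq> \<infinity>" if a: "a \<in> A" for a
  proof -
    have "emeasure mq (sect -` a \<inter> Mq) = emeasure m (fund \<inter> q -` (sect -` a \<inter> Mq))"
      using calculation[OF a] by (simp add: emeasure_mq)
    also have "\<dots> \<le> emeasure m a"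
      using a A(2) by (intro emeasure_mono) (auto simp: fund_def)
    also have "\<dots> < \<infinity>" using a A(4) by (simp add: top.not_eq_extremum)
    finally show ?thesis by simp
  qed
  moreover have "\<Union>?A = Mq" using A(3) sect by auto
  ultimately show ?thesis
    using A(1) by (intro sigma_finite_measure.intro exI[of _ ?A]) auto
qed

text \<open>A small neighbourhood of a point of the quotient lifts to a sheet, with the same measure.\<close>

lemma Q_full_support: "Q.msupport mq = Mq"
proof -
  have "emeasure mq W > 0" if W: "openin Q.mtopology W" and x: "x \<in> M" "q x \<in> W" for W x
  proof -
    obtain r where r: "r > 0" "isometric_on (mball x r)" using isometric_ball x by blast
    let ?U = "mball x r \<inter> {y \<in> topspace mtopology. q y \<in> W}"
    have U: "openin mtopology ?U"
      using W continuous_map_q by (intro openin_Int) (auto simp: continuous_map_def)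
    have "x \<in> ?U" using r x by simp
    moreover have "x \<in> msupport m" using full_support x by simp
    ultimately have "0 < emeasure m ?U" using U unfolding msupport_def by blast
    also have "?U = ?U \<inter> q -` (q ` ?U)" by blast
    also have "emeasure m \<dots> = emeasure mq (q ` ?U)"
      using U openin_mborel[OF U] borel Q.openin_mborel[OF open_map_q[OF U]]
      by (intro emeasure_mq_sheet[symmetric] isometric_on_inj isometric_on_subset[OF r(2)]) auto
    also have "\<dots> \<le> emeasure mq W"
      using Q.openin_mborel[OF W] by (intro emeasure_mono) auto
    finally show ?thesis .
  qed
  then show ?thesis by (auto simp: Q.msupport_def elim!: MqE)
qed

theorem quotient_metric_measure_space: "metric_measure_space Mq dq mq"
  by unfold_locales
    (use Q.mcomplete_if_proper Q_proper Q_separable Q_geodesic Q_sigma_finite Q_full_support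
      in \<open>auto simp: sigma_finite_measure_def\<close>)

sublocale Q: metric_measure_space Mq dq mq
  by (rule quotient_metric_measure_space)

end

section \<open>Maps between spaces of geodesics\<close>

lemma measurable_piecewise_continuous:
  assumes A: "\<And>i. i \<in> I \<Longrightarrow> A i \<in> sets (borel_of T)" "countable I" "(\<Union>i\<in>I. A i) = topspace T"
    and f: "\<And>i. i \<in> I \<Longrightarrow> continuous_map (subtopology T (A i)) S f"
  shows "f \<in> borel_of T \<rightarrow>\<^sub>M borel_of S"
proof (rule measurable_borel_ofI)
  show "f \<in> space (borel_of T) \<rightarrow> topspace S"
  proof
    fix x assume "x \<in> space (borel_of T)"
    then obtain i where i: "i \<in> I" "x \<in> A i" "x \<in> topspace T" using A(3) by auto
    then show "f x \<in> topspace S" using f[of i] by (auto simp: continuous_map_def Pi_iff)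
  qed
  fix U assume U: "openin S U"
  have "f -` U \<inter> A i \<inter> topspace T \<in> sets (borel_of T)" if i: "i \<in> I" for i
  proof -
    have "openin (subtopology T (A i)) {x \<in> topspace (subtopology T (A i)). f x \<in> U}"
      using f[OF i] U by (simp add: continuous_map_def)
    then obtain V where "openin T V" "{x \<in> topspace (subtopology T (A i)). f x \<in> U} = V \<inter> A i"
      by (auto simp: openin_subtopology)
    moreover have "f -` U \<inter> A i \<inter> topspace T = {x \<in> topspace (subtopology T (A i)). f x \<in> U}"
      by auto
    ultimately show ?thesis using A(1)[OF i] openin_borel_of[of T V] by auto
  qed
  then have "(\<Union>i\<in>I. f -` U \<inter> A i \<inter> topspace T) \<in> sets (borel_of T)"
    using A(2) by (intro sets.countable_UN'')
  moreover have "(\<Union>i\<in>I. f -` U \<inter> A i \<inter> topspace T) = f -` U \<inter> space (borel_of T)"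
    using A(3) by auto
  ultimately show "f -` U \<inter> space (borel_of T) \<in> sets (borel_of T)" by simp
qed

text \<open>Stated for two arbitrary spaces, as it serves for projecting geodesics to the quotient as well as
  for lifting them.\<close>

lemma (in Metric_space12) continuous_map_Geo:
  assumes f: "\<And>\<gamma>. \<gamma> \<in> M1.Geo \<Longrightarrow> \<gamma> \<in> A \<Longrightarrow> f \<gamma> \<in> M2.Geo"
    and cont: "\<And>\<gamma> e. \<gamma> \<in> M1.Geo \<Longrightarrow> \<gamma> \<in> A \<Longrightarrow> 0 < e \<Longrightarrow> \<exists>\<delta>>0. \<forall>\<eta>\<in>M1.Geo \<inter> A.
      (\<forall>t\<in>{0..1}. d1 (\<gamma> t) (\<eta> t) < \<delta>) \<longrightarrow> (\<forall>t\<in>{0..1}. d2 (f \<gamma> t) (f \<eta> t) < e)"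
  shows "continuous_map (subtopology M1.Geo_topology A) M2.Geo_topology f"
  unfolding continuous_map_def
proof (intro conjI allI impI)
  show "f \<in> topspace (subtopology M1.Geo_topology A) \<rightarrow> topspace M2.Geo_topology"
    using f by auto
  fix U assume U: "openin M2.Geo_topology U"
  define V where "V = {\<gamma> \<in> M1.Geo. \<exists>e>0. \<forall>\<eta>\<in>M1.Geo \<inter> A.
    (\<forall>t\<in>{0..1}. d1 (\<gamma> t) (\<eta> t) < e) \<longrightarrow> f \<eta> \<in> U}"
  have "openin M1.Geo_topology V"
    unfolding M1.openin_Geo_topology
  proof (intro conjI ballI)
    show "V \<subseteq> M1.Geo" by (auto simp: V_def)
    fix \<gamma> assume "\<gamma> \<in> V"
    then obtain e where \<gamma>: "\<gamma> \<in> M1.Geo" and e: "e > 0"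
      "\<And>\<eta>. \<eta> \<in> M1.Geo \<Longrightarrow> \<eta> \<in> A \<Longrightarrow> \<forall>t\<in>{0..1}. d1 (\<gamma> t) (\<eta> t) < e \<Longrightarrow> f \<eta> \<in> U"
      unfolding V_def by blast
    have "\<gamma>' \<in> V" if \<gamma>': "\<gamma>' \<in> M1.Geo" "\<forall>t\<in>{0..1}. d1 (\<gamma> t) (\<gamma>' t) < e / 2" for \<gamma>'
    proof -
      have "f \<eta> \<in> U" if \<eta>: "\<eta> \<in> M1.Geo" "\<eta> \<in> A" "\<forall>t\<in>{0..1}. d1 (\<gamma>' t) (\<eta> t) < e / 2" for \<eta>
      proof (rule e(2)[OF \<eta>(1,2)], rule ballI)
        fix t :: real assume t: "t \<in> {0..1}"
        have "d1 (\<gamma> t) (\<eta> t) \<le> d1 (\<gamma> t) (\<gamma>' t) + d1 (\<gamma>' t) (\<eta> t)"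
          using t \<gamma> \<gamma>' \<eta> M1.Geo_in_M by (intro M1.triangle) auto
        also have "\<dots> < e / 2 + e / 2"
          using t \<gamma>'(2) \<eta>(3) by (intro add_strict_mono) auto
        finally show "d1 (\<gamma> t) (\<eta> t) < e" by simp
      qed
      then show ?thesis unfolding V_def using \<gamma>'(1) half_gt_zero[OF e(1)] by blast
    qed
    then show "\<exists>e>0. \<forall>\<eta>\<in>M1.Geo. (\<forall>t\<in>{0..1}. d1 (\<gamma> t) (\<eta> t) < e) \<longrightarrow> \<eta> \<in> V"
      using half_gt_zero[OF e(1)] by blast
  qed
  moreover have "{\<gamma> \<in> topspace (subtopology M1.Geo_topology A). f \<gamma> \<in> U} = V \<inter> A"
  proof (intro equalityI subsetI)
    fix \<gamma> assume "\<gamma> \<in> {\<gamma> \<in> topspace (subtopology M1.Geo_topology A). f \<gamma> \<in> U}"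
    then have \<gamma>: "\<gamma> \<in> M1.Geo" "\<gamma> \<in> A" "f \<gamma> \<in> U" by auto
    obtain e where e: "e > 0"
      "\<And>\<eta>. \<eta> \<in> M2.Geo \<Longrightarrow> \<forall>t\<in>{0..1}. d2 (f \<gamma> t) (\<eta> t) < e \<Longrightarrow> \<eta> \<in> U"
      using U \<gamma>(3) unfolding M2.openin_Geo_topology by blast
    obtain \<delta> where "\<delta> > 0" "\<And>\<eta>. \<eta> \<in> M1.Geo \<Longrightarrow> \<eta> \<in> A \<Longrightarrow> \<forall>t\<in>{0..1}. d1 (\<gamma> t) (\<eta> t) < \<delta> \<Longrightarrow>
        \<forall>t\<in>{0..1}. d2 (f \<gamma> t) (f \<eta> t) < e"
      using cont[OF \<gamma>(1,2) e(1)] by blast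
    then have "\<forall>\<eta>\<in>M1.Geo \<inter> A. (\<forall>t\<in>{0..1}. d1 (\<gamma> t) (\<eta> t) < \<delta>) \<longrightarrow> f \<eta> \<in> U"
      using e(2) f by (metis IntD1 IntD2)
    then show "\<gamma> \<in> V \<inter> A" unfolding V_def using \<gamma> \<open>\<delta> > 0\<close> by blast
  next
    fix \<gamma> assume "\<gamma> \<in> V \<inter> A"
    then obtain e where \<gamma>: "\<gamma> \<in> M1.Geo" "\<gamma> \<in> A" and e: "e > 0"
      "\<forall>\<eta>\<in>M1.Geo \<inter> A. (\<forall>t\<in>{0..1}. d1 (\<gamma> t) (\<eta> t) < e) \<longrightarrow> f \<eta> \<in> U"
      unfolding V_def by blast
    have "\<forall>t\<in>{0..1}. d1 (\<gamma> t) (\<gamma> t) < e" using \<gamma> e(1) M1.Geo_in_M by simp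
    then show "\<gamma> \<in> {\<gamma> \<in> topspace (subtopology M1.Geo_topology A). f \<gamma> \<in> U}"
      using \<gamma> e(2) by auto
  qed
  ultimately show "openin (subtopology M1.Geo_topology A)
      {\<gamma> \<in> topspace (subtopology M1.Geo_topology A). f \<gamma> \<in> U}"
    by (auto simp: openin_subtopology)
qed

section \<open>The measure contraction property of the quotient\<close>

context free_isometric_action
begin

definition projectable :: "(real \<Rightarrow> 'a) set" where
  "projectable = {\<gamma> \<in> Geo. dq (q (\<gamma> 0)) (q (\<gamma> 1)) = d (\<gamma> 0) (\<gamma> 1)}"

text \<open>Geodesics whose projections need not be geodesics are mapped to constant ones, to obtain a map into
  the space of geodesics that is defined everywhere and continuous on both parts of its domain.\<close>

definition project :: "(real \<Rightarrow> 'a) \<Rightarrow> real \<Rightarrow> 'a set" where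
  "project \<gamma> = 
    (if \<gamma> \<in> projectable then (\<lambda>t\<in>{0..1}. q (\<gamma> t)) else (\<lambda>t\<in>{0..1}. q (\<gamma> 0)))"

lemma project_Geo: "\<gamma> \<in> Geo \<Longrightarrow> project \<gamma> \<in> Q.Geo"
  using Geo_q Q.const_Geo Geo_in_M by (auto simp: project_def projectable_def)

lemma project_0 [simp]: "project \<gamma> 0 = q (\<gamma> 0)"
  by (simp add: project_def)

lemma projectable_measurable: "projectable \<in> sets (borel_of Geo_topology)"
proof -
  have "(\<lambda>\<gamma>. dq (q (\<gamma> 0)) (q (\<gamma> 1))) \<in> borel_measurable (borel_of Geo_topology)"
    using continuous_map_mdist[of Geo_topology "metric (Mq, dq)" "\<lambda>\<gamma>. q (\<gamma> 0)" "\<lambda>\<gamma>. q (\<gamma> 1)"]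
      continuous_map_compose[OF continuous_map_eval continuous_map_q, of 0]
      continuous_map_compose[OF continuous_map_eval continuous_map_q, of 1]
    by (intro borel_measurable_continuous_map) (simp add: comp_def)
  then have "{\<gamma> \<in> space (borel_of Geo_topology).
      dq (q (\<gamma> 0)) (q (\<gamma> 1)) = d (\<gamma> 0) (\<gamma> 1)} \<in> sets (borel_of Geo_topology)"
    using measurable_length by measurable
  then show ?thesis by (simp add: projectable_def)
qed

lemma measurable_project: "project \<in> borel_of Geo_topology \<rightarrow>\<^sub>M borel_of Q.Geo_topology"
proof -
  interpret MQ: Metric_space12 M d Mq dq ..
  have sub: "projectable \<subseteq> Geo" by (auto simp: projectable_def)
  have close: "dq (q (\<gamma> s)) (q (\<eta> s)) < e"
    if "\<gamma> \<in> Geo" "\<eta> \<in> Geo" "\<forall>t\<in>{0..1}. d (\<gamma> t) (\<eta> t) < e" "s \<in> {0..1}" for \<gamma> \<eta> s e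
    using that dq_le[of "\<gamma> s" "\<eta> s"] Geo_in_M by (force intro: le_less_trans)
  have "continuous_map (subtopology Geo_topology A) Q.Geo_topology project"
    if "A = projectable \<or> A = Geo - projectable" for A
  proof (rule MQ.continuous_map_Geo)
    show "project \<gamma> \<in> Q.Geo" if "\<gamma> \<in> Geo" for \<gamma> using that by (rule project_Geo)
    fix \<gamma> and e :: real assume \<gamma>: "\<gamma> \<in> Geo" "\<gamma> \<in> A" and e: "0 < e"
    have "dq (project \<gamma> t) (project \<eta> t) < e"
      if "\<eta> \<in> Geo" "\<eta> \<in> A" "\<forall>t\<in>{0..1}. d (\<gamma> t) (\<eta> t) < e" "t \<in> {0..1}" for \<eta> t
      using that \<gamma> \<open>A = _ \<or> _\<close> close[of \<gamma> \<eta> e t] close[of \<gamma> \<eta> e 0] by (auto simp: project_def)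
    then show "\<exists>\<delta>>0. \<forall>\<eta>\<in>Geo \<inter> A. (\<forall>t\<in>{0..1}. d (\<gamma> t) (\<eta> t) < \<delta>) \<longrightarrow>
        (\<forall>t\<in>{0..1}. dq (project \<gamma> t) (project \<eta> t) < e)"
      using e by blast
  qed
  moreover have "Geo - projectable \<in> sets (borel_of Geo_topology)"
    using sets.compl_sets[OF projectable_measurable] by simp
  ultimately show ?thesis
    using projectable_measurable sub
    by (intro measurable_piecewise_continuous[of "{projectable, Geo - projectable}" "\<lambda>A. A"]) auto
qed

lemma distr_uniform_measure_q:
  assumes B: "B \<in> sets m" "inj_on q B" and A: "A \<in> sets mq" "A \<subseteq> q ` B"
  shows "distr (uniform_measure m (B \<inter> q -` A)) Q.mborel q = uniform_measure mq A"
proof (rule measure_eqI)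
  let ?A = "B \<inter> q -` A"
  have A': "?A \<in> sets m" using A B by (intro sets_vimage_Int) auto
  have q: "q \<in> uniform_measure m ?A \<rightarrow>\<^sub>M Q.mborel"
    using measurable_q_m by (simp add: uniform_measure_def)
  fix E assume "E \<in> sets (distr (uniform_measure m ?A) Q.mborel q)"
  then have E: "E \<in> sets Q.mborel" by simp
  have "emeasure (distr (uniform_measure m ?A) Q.mborel q) E =
      emeasure m (?A \<inter> (q -` E \<inter> M)) / emeasure m ?A"
    using A' E q_vimage_measurable by (simp add: emeasure_distr[OF q])
  also have "?A \<inter> (q -` E \<inter> M) = B \<inter> q -` (A \<inter> E)"
    using sets.sets_into_space[OF B(1)] by auto
  also have "emeasure m \<dots> = emeasure mq (A \<inter> E)"
    using A E by (intro emeasure_mq_sheet[symmetric] B) auto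
  also have "emeasure m ?A = emeasure mq A"
    using A by (intro emeasure_mq_sheet[symmetric] B) auto
  also have "emeasure mq (A \<inter> E) / emeasure mq A = emeasure (uniform_measure mq A) E"
    using A E by simp
  finally show "emeasure (distr (uniform_measure m ?A) Q.mborel q) E =
      emeasure (uniform_measure mq A) E" .
qed simp

text \<open>The factor \<open>3\<close> ensures that geodesics with end points in the ball of radius \<open>r\<close> remain in a set on
  which \<open>q\<close> is injective. Without that, the preimage of \<open>E\<close> would consist of many copies of \<open>E\<close>, and the
  bound for the preimage would say nothing about \<open>E\<close>.\<close>

lemma project_transport:
  assumes x: "x \<in> M" and iso: "isometric_on (mball x (3 * r))"
    and p: "p \<in> mball x r"
    and A: "A \<in> sets mq" "A \<subseteq> q ` mball x r" "0 < emeasure mq A" "emeasure mq A < \<infinity>"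
    and \<nu>: "\<nu> \<in> OptGeo (uniform_measure m (mball x r \<inter> q -` A)) (return mborel p)"
    and MCP: "\<And>t E. t \<in> {0..1} \<Longrightarrow> E \<in> sets m \<Longrightarrow>
      emeasure (distr (density \<nu> (\<lambda>\<gamma>. ennreal_powr (tau K N (1 - t) (d (\<gamma> 0) (\<gamma> 1))) N)) mborel
        (\<lambda>\<gamma>. \<gamma> t)) E \<le> emeasure m E / emeasure m (mball x r \<inter> q -` A)"
  defines "\<nu>' \<equiv> distr \<nu> (borel_of Q.Geo_topology) project"
  shows "\<nu>' \<in> Q.OptGeo (uniform_measure mq A) (return Q.mborel (q p))"
    and "\<And>t E. t \<in> {0..1} \<Longrightarrow> E \<in> sets mq \<Longrightarrow>
      emeasure (distr (density \<nu>' (\<lambda>\<gamma>. ennreal_powr (tau K N (1 - t) (dq (\<gamma> 0) (\<gamma> 1))) N)) Q.mborel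
        (\<lambda>\<gamma>. \<gamma> t)) E \<le> emeasure mq E / emeasure mq A"
proof -
  let ?B = "mball x r" and ?B3 = "mball x (3 * r)"
  let ?A = "?B \<inter> q -` A"
  have r: "r > 0" using p nonneg by (meson in_mball le_less_trans)
  have B: "?B \<in> sets m" "?B3 \<in> sets m" using openin_mborel borel by auto
  have sub: "?B \<subseteq> ?B3" using r by (intro mball_subset_concentric) simp
  have "inj_on q ?B3" using iso mball_subset_mspace by (rule isometric_on_inj)
  with sub have inj: "inj_on q ?B" "inj_on q ?B3" by (blast intro: inj_on_subset)+
  have mA: "emeasure m ?A = emeasure mq A"
    using A(1,2) by (intro emeasure_mq_sheet[symmetric] B inj) auto
  have A': "?A \<in> sets m" using A(1) B by (intro sets_vimage_Int) auto
  note mg = OptGeo_marginals[OF \<nu>]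
  have pr: "project \<in> \<nu> \<rightarrow>\<^sub>M borel_of Q.Geo_topology"
    using measurable_project by (simp add: measurable_cong_sets[OF mg(1) refl])
  have ev: "(\<lambda>\<gamma>. \<gamma> t) \<in> \<nu> \<rightarrow>\<^sub>M mborel" if "t \<in> {0..1}" for t
    using measurable_eval[OF that] by (simp add: measurable_cong_sets[OF mg(1) refl])
  have "AE y in uniform_measure m ?A. y \<in> ?A"
    using A' A mA by (intro AE_uniform_measureI) auto
  then have start: "AE \<gamma> in \<nu>. \<gamma> 0 \<in> ?A"
    unfolding mg(3)[symmetric] by (rule AE_distrD[OF ev, rotated]) simp
  have "AE y in return mborel p. y = p" using p by (intro AE_return_mborel) simp
  then have "AE \<gamma> in \<nu>. \<gamma> 1 = p"
    unfolding mg(4)[symmetric] by (rule AE_distrD[OF ev, rotated]) simp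
  moreover have "AE \<gamma> in \<nu>. \<gamma> \<in> Geo"
    using sets_eq_imp_space_eq[OF mg(1)] by (intro AE_I2) simp
  ultimately have good: "AE \<gamma> in \<nu>. \<gamma> \<in> projectable \<and> \<gamma> 0 \<in> ?B \<and> \<gamma> 1 = p"
    using start
  proof eventually_elim
    case (elim \<gamma>)
    then have "dq (q (\<gamma> 0)) (q p) = d (\<gamma> 0) p"
      using iso p sub unfolding isometric_on_def by blast
    then show ?case using elim by (simp add: projectable_def)
  qed
  have sets': "sets \<nu>' = sets (borel_of Q.Geo_topology)" by (simp add: \<nu>'_def)
  have "distr \<nu>' Q.mborel (\<lambda>\<gamma>. \<gamma> 0) = distr \<nu> Q.mborel (\<lambda>\<gamma>. q (\<gamma> 0))"
    unfolding \<nu>'_def by (subst distr_distr[OF Q.measurable_eval pr]) (simp_all add: comp_def)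
  also have "\<dots> = distr (distr \<nu> mborel (\<lambda>\<gamma>. \<gamma> 0)) Q.mborel q"
    by (subst distr_distr[OF measurable_q ev]) (simp_all add: comp_def)
  also have "\<dots> = uniform_measure mq A"
    unfolding mg(3) by (rule distr_uniform_measure_q[OF B(1) inj(1) A(1,2)])
  finally have m0: "distr \<nu>' Q.mborel (\<lambda>\<gamma>. \<gamma> 0) = uniform_measure mq A" .
  have "distr \<nu>' Q.mborel (\<lambda>\<gamma>. \<gamma> 1) = distr \<nu> Q.mborel (\<lambda>\<gamma>. project \<gamma> 1)"
    unfolding \<nu>'_def by (subst distr_distr[OF Q.measurable_eval pr]) (simp_all add: comp_def)
  also have "\<dots> = distr \<nu> Q.mborel (\<lambda>\<gamma>. q (\<gamma> 1))"
  proof (rule distr_cong_AE)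
    show "AE \<gamma> in \<nu>. project \<gamma> 1 = q (\<gamma> 1)"
      using good by eventually_elim (simp add: project_def)
    show "(\<lambda>\<gamma>. project \<gamma> 1) \<in> \<nu> \<rightarrow>\<^sub>M Q.mborel"
      by (rule measurable_compose[OF pr Q.measurable_eval]) simp
    show "(\<lambda>\<gamma>. q (\<gamma> 1)) \<in> \<nu> \<rightarrow>\<^sub>M Q.mborel"
      by (rule measurable_compose[OF ev measurable_q]) simp
  qed simp_all
  also have "\<dots> = distr (distr \<nu> mborel (\<lambda>\<gamma>. \<gamma> 1)) Q.mborel q"
    by (subst distr_distr[OF measurable_q ev]) (simp_all add: comp_def)
  also have "\<dots> = return Q.mborel (q p)"
    unfolding mg(4) using p by (intro distr_return measurable_q) auto
  finally have m1: "distr \<nu>' Q.mborel (\<lambda>\<gamma>. \<gamma> 1) = return Q.mborel (q p)" .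
  have "prob_space \<nu>'" unfolding \<nu>'_def using mg(2) pr by (rule prob_space.prob_space_distr)
  then show "\<nu>' \<in> Q.OptGeo (uniform_measure mq A) (return Q.mborel (q p))"
    using sets' Q.couplings_dirac_optimal[OF _ Q.endpoint_coupling[OF sets' m0 m1]] p
    by (simp add: Q.OptGeo_def)
  fix t :: real and E assume t: "t \<in> {0..1}" and "E \<in> sets mq"
  then have E: "E \<in> sets Q.mborel" by simp
  let ?f = "\<lambda>\<gamma>. ennreal_powr (tau K N (1 - t) (d (\<gamma> 0) (\<gamma> 1))) N"
  let ?f' = "\<lambda>\<gamma>. ennreal_powr (tau K N (1 - t) (dq (\<gamma> 0) (\<gamma> 1))) N"
  have E3: "?B3 \<inter> q -` E \<in> sets m" using B(2) E by (intro sets_vimage_Int) auto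
  have "emeasure (distr (density \<nu>' ?f') Q.mborel (\<lambda>\<gamma>. \<gamma> t)) E =
      (\<integral>\<^sup>+ \<gamma>. ?f' \<gamma> * indicator E (\<gamma> t) \<partial>\<nu>')"
    by (rule Q.emeasure_distr_eval[OF sets' Q.measurable_distortion t E])
  also have "\<dots> = (\<integral>\<^sup>+ \<gamma>. ?f' (project \<gamma>) * indicator E (project \<gamma> t) \<partial>\<nu>)"
    unfolding \<nu>'_def
  proof (rule nn_integral_distr[OF pr])
    have "(\<lambda>\<gamma>. indicator E (\<gamma> t) :: ennreal) \<in> borel_measurable (borel_of Q.Geo_topology)"
      using E by (intro measurable_compose[OF Q.measurable_eval[OF t]]) simp
    then show "(\<lambda>\<gamma>. ?f' \<gamma> * indicator E (\<gamma> t)) \<in> borel_measurable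
        (distr \<nu> (borel_of Q.Geo_topology) project)"
      using Q.measurable_distortion by simp
  qed
  also have "\<dots> = (\<integral>\<^sup>+ \<gamma>. ?f \<gamma> * indicator (?B3 \<inter> q -` E) (\<gamma> t) \<partial>\<nu>)"
  proof (rule nn_integral_cong_AE)
    show "AE \<gamma> in \<nu>. ?f' (project \<gamma>) * indicator E (project \<gamma> t) =
        ?f \<gamma> * indicator (?B3 \<inter> q -` E) (\<gamma> t)"
      using good
    proof eventually_elim
      case (elim \<gamma>)
      then have \<gamma>: "\<gamma> \<in> Geo" "\<gamma> 0 \<in> M" "p \<in> M" "\<gamma> t \<in> M"
        and l: "dq (q (\<gamma> 0)) (q (\<gamma> 1)) = d (\<gamma> 0) (\<gamma> 1)"
        using Geo_in_M t p by (auto simp: projectable_def)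
      \<comment> \<open>The whole geodesic stays in the ball of radius \<open>3r\<close>, on which \<open>q\<close> is injective.\<close>
      have "d (\<gamma> 0) (\<gamma> t) = t * d (\<gamma> 0) (\<gamma> 1)" using Geo_dist[OF \<gamma>(1), of 0 t] t by simp
      also have "\<dots> \<le> 1 * d (\<gamma> 0) (\<gamma> 1)" using t by (intro mult_right_mono) auto
      also have "\<dots> < 2 * r" using elim p \<gamma> triangle[of "\<gamma> 0" x p] x by (simp add: commute)
      finally have "d x (\<gamma> t) < 3 * r" using triangle[of x "\<gamma> 0" "\<gamma> t"] x \<gamma> elim by simp
      then have "\<gamma> t \<in> ?B3" using x \<gamma> by simp
      then show ?case using elim t l by (auto simp: project_def indicator_def)
    qed
  qed
  also have "\<dots> = emeasure (distr (density \<nu> ?f) mborel (\<lambda>\<gamma>. \<gamma> t)) (?B3 \<inter> q -` E)"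
    using E3 borel by (intro emeasure_distr_eval[symmetric] mg(1) measurable_distortion t) simp
  also have "\<dots> \<le> emeasure m (?B3 \<inter> q -` E) / emeasure mq A"
    using MCP[OF t E3] by (simp add: mA)
  also have "emeasure m (?B3 \<inter> q -` E) = emeasure mq (E \<inter> q ` ?B3)"
  proof -
    have "E \<inter> q ` ?B3 \<in> sets Q.mborel"
      using E Q.openin_mborel[OF open_map_q[OF openin_mball]] by auto
    then have "emeasure mq (E \<inter> q ` ?B3) = emeasure m (?B3 \<inter> q -` (E \<inter> q ` ?B3))"
      by (intro emeasure_mq_sheet B inj) auto
    also have "?B3 \<inter> q -` (E \<inter> q ` ?B3) = ?B3 \<inter> q -` E" by auto
    finally show ?thesis by simp
  qed
  also have "emeasure mq (E \<inter> q ` ?B3) / emeasure mq A \<le> emeasure mq E / emeasure mq A"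
    using E by (intro divide_right_mono_ennreal emeasure_mono) auto
  finally show "emeasure (distr (density \<nu>' ?f') Q.mborel (\<lambda>\<gamma>. \<gamma> t)) E \<le>
      emeasure mq E / emeasure mq A" .
qed

theorem Q_MCP_loc:
  assumes "MCP_loc K N"
  shows "Q.MCP_loc K N"
proof -
  obtain \<O> where \<O>: "\<Union>\<O> = M" and cover: "\<forall>U\<in>\<O>. openin mtopology U \<and>
     (\<forall>p\<in>U. \<forall>A\<in>sets m.
        A \<subseteq> U \<and> 0 < emeasure m A \<and> emeasure m A < \<infinity> \<and> uniform_measure m A \<in> Pc \<longrightarrow>
        (\<exists>\<nu>\<in>OptGeo (uniform_measure m A) (return mborel p). \<forall>t\<in>{0..1}. \<forall>E\<in>sets m.
           emeasure m E / emeasure m A \<ge>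
           emeasure (distr (density \<nu> (\<lambda>\<gamma>. ennreal_powr (tau K N (1 - t) (d (\<gamma> 0) (\<gamma> 1))) N))
                      mborel (\<lambda>\<gamma>. \<gamma> t)) E))"
    using assms unfolding MCP_loc_def by (elim exE conjE) (rule that)
  have MCP: "\<exists>\<nu>\<in>OptGeo (uniform_measure m A) (return mborel p). \<forall>t\<in>{0..1}. \<forall>E\<in>sets m.
      emeasure m E / emeasure m A \<ge>
      emeasure (distr (density \<nu> (\<lambda>\<gamma>. ennreal_powr (tau K N (1 - t) (d (\<gamma> 0) (\<gamma> 1))) N))
        mborel (\<lambda>\<gamma>. \<gamma> t)) E"
    if "U \<in> \<O>" "p \<in> U" "A \<in> sets m" "A \<subseteq> U" "0 < emeasure m A" "emeasure m A < \<infinity>"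
      "uniform_measure m A \<in> Pc" for U p A
    by (rule mp[OF bspec[OF bspec[OF conjunct2[OF bspec[OF cover that(1)]] that(2)] that(3)]])
      (intro conjI that)
  have "\<exists>r>0. isometric_on (mball x (3 * r)) \<and> (\<exists>U\<in>\<O>. mball x r \<subseteq> U)" if x: "x \<in> M" for x
  proof -
    obtain U where U: "U \<in> \<O>" "x \<in> U" using x \<O> by blast
    then obtain r1 where r1: "r1 > 0" "mball x r1 \<subseteq> U"
      using cover openin_mtopology[of U] by metis
    obtain r2 where r2: "r2 > 0" "isometric_on (mball x r2)" using isometric_ball[OF x] by blast
    let ?r = "min r1 (r2 / 3)"
    have "mball x ?r \<subseteq> mball x r1" "mball x (3 * ?r) \<subseteq> mball x r2"
      by (intro mball_subset_concentric, simp)+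
    then have "mball x ?r \<subseteq> U" "isometric_on (mball x (3 * ?r))"
      using r1 r2 isometric_on_subset by blast+
    moreover have "?r > 0" using r1 r2 by simp
    ultimately show ?thesis using U(1) by blast
  qed
  then obtain \<rho> where \<rho>: "\<And>x. x \<in> M \<Longrightarrow> \<rho> x > 0"
    "\<And>x. x \<in> M \<Longrightarrow> isometric_on (mball x (3 * \<rho> x))"
    "\<And>x. x \<in> M \<Longrightarrow> \<exists>U\<in>\<O>. mball x (\<rho> x) \<subseteq> U"
    by metis
  let ?\<O> = "(\<lambda>x. q ` mball x (\<rho> x)) ` M"
  have "\<Union>?\<O> = Mq"
  proof (intro equalityI subsetI)
    fix X assume "X \<in> \<Union>?\<O>"
    then show "X \<in> Mq" by auto
  next
    fix X assume "X \<in> Mq"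
    then obtain x where "x \<in> M" "X = q x" by (rule MqE)
    then show "X \<in> \<Union>?\<O>" using \<rho>(1) by blast
  qed
  moreover have "\<exists>\<nu>\<in>Q.OptGeo (uniform_measure mq A) (return Q.mborel P). \<forall>t\<in>{0..1}. \<forall>E\<in>sets mq.
      emeasure mq E / emeasure mq A \<ge>
      emeasure (distr (density \<nu> (\<lambda>\<gamma>. ennreal_powr (tau K N (1 - t) (dq (\<gamma> 0) (\<gamma> 1))) N))
        Q.mborel (\<lambda>\<gamma>. \<gamma> t)) E"
    if x: "x \<in> M" and P: "P \<in> q ` mball x (\<rho> x)" and A: "A \<in> sets mq" "A \<subseteq> q ` mball x (\<rho> x)"
      "0 < emeasure mq A" "emeasure mq A < \<infinity>" for x P A
  proof -
    obtain p where p: "p \<in> mball x (\<rho> x)" "P = q p" using P by blast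
    obtain U where U: "U \<in> \<O>" "mball x (\<rho> x) \<subseteq> U" using \<rho>(3)[OF x] by blast
    let ?A = "mball x (\<rho> x) \<inter> q -` A"
    have B: "mball x (\<rho> x) \<in> sets m" using openin_mborel borel by auto
    have A': "?A \<in> sets m" using A(1) B by (intro sets_vimage_Int) auto
    have "mball x (\<rho> x) \<subseteq> mball x (3 * \<rho> x)"
      using \<rho>(1)[OF x] by (intro mball_subset_concentric) simp
    with isometric_on_inj[OF \<rho>(2)[OF x] mball_subset_mspace]
    have "inj_on q (mball x (\<rho> x))" by (rule inj_on_subset)
    then have mA: "emeasure m ?A = emeasure mq A"
      using A(1,2) by (intro emeasure_mq_sheet[symmetric] B) auto
    have "AE y in uniform_measure m ?A. y \<in> mcball x (\<rho> x)"
      using A' A mA by (intro AE_uniform_measureI) auto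
    then have "compactin mtopology (msupport (uniform_measure m ?A))"
      using proper[OF x] by (rule compactin_msupport) (simp add: borel)
    moreover have "prob_space (uniform_measure m ?A)"
      using A mA by (intro prob_space_uniform_measure) auto
    ultimately have "uniform_measure m ?A \<in> Pc" by (simp add: Pc_def borel)
    with p U A' A mA have "\<exists>\<nu>\<in>OptGeo (uniform_measure m ?A) (return mborel p).
      \<forall>t\<in>{0..1}. \<forall>E\<in>sets m. emeasure m E / emeasure m ?A \<ge>
        emeasure (distr (density \<nu> (\<lambda>\<gamma>. ennreal_powr (tau K N (1 - t) (d (\<gamma> 0) (\<gamma> 1))) N))
          mborel (\<lambda>\<gamma>. \<gamma> t)) E"
      by (intro MCP[OF U(1)]) auto
    then obtain \<nu> where \<nu>: "\<nu> \<in> OptGeo (uniform_measure m ?A) (return mborel p)"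
      "\<And>t E. t \<in> {0..1} \<Longrightarrow> E \<in> sets m \<Longrightarrow>
        emeasure (distr (density \<nu> (\<lambda>\<gamma>. ennreal_powr (tau K N (1 - t) (d (\<gamma> 0) (\<gamma> 1))) N))
          mborel (\<lambda>\<gamma>. \<gamma> t)) E \<le> emeasure m E / emeasure m ?A"
      by blast
    show ?thesis
      using project_transport[OF x \<rho>(2)[OF x] p(1) A \<nu>] unfolding p(2) by blast
  qed
  moreover have "openin Q.mtopology (q ` mball x (\<rho> x))" for x
    by (intro open_map_q openin_mball)
  ultimately show ?thesis
    unfolding Q.MCP_loc_def by (intro exI[of _ ?\<O>]) auto
qed

end

section \<open>Lifting geodesics\<close>

context free_isometric_action
begin

text \<open>The distance of the two curves is a continuous function of time. As long as it is less than
  \<open>e\<close>, it equals the distance of the projections and is therefore less than \<open>e / 2\<close>; so it cannot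
  cross the interval between \<open>e / 2\<close> and \<open>e\<close>.\<close>

lemma dist_curves_eq_dq:
  fixes T :: real
  assumes e: "\<And>y z. y \<in> mcball x r \<Longrightarrow> z \<in> M \<Longrightarrow> d y z < e \<Longrightarrow> dq (q y) (q z) = d y z"
    and \<gamma>: "continuous_map (top_of_set {0..T}) mtopology \<gamma>" "\<And>t. t \<in> {0..T} \<Longrightarrow> \<gamma> t \<in> mcball x r"
    and \<eta>: "continuous_map (top_of_set {0..T}) mtopology \<eta>" "\<And>t. t \<in> {0..T} \<Longrightarrow> \<eta> t \<in> M"
    and start: "d (\<gamma> 0) (\<eta> 0) < e"
    and close: "\<And>t. t \<in> {0..T} \<Longrightarrow> dq (q (\<gamma> t)) (q (\<eta> t)) < e / 2"
    and t: "t \<in> {0..T}"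
  shows "d (\<gamma> t) (\<eta> t) = dq (q (\<gamma> t)) (q (\<eta> t))"
proof -
  have eq: "d (\<gamma> s) (\<eta> s) = dq (q (\<gamma> s)) (q (\<eta> s))" if "s \<in> {0..T}" "d (\<gamma> s) (\<eta> s) < e" for s
    using e[OF \<gamma>(2) \<eta>(2)] that by simp
  have cont: "continuous_on {0..T} (\<lambda>s. d (\<gamma> s) (\<eta> s))"
    using continuous_map_mdist[of "top_of_set {0..T}" "metric (M, d)" \<gamma> \<eta>] \<gamma>(1) \<eta>(1) by simp
  have "d (\<gamma> t) (\<eta> t) < e"
  proof (rule ccontr)
    assume "\<not> d (\<gamma> t) (\<eta> t) < e"
    moreover have "d (\<gamma> 0) (\<eta> 0) < e / 2" using eq[of 0] close[of 0] start t by simp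
    moreover have "0 < e" using start nonneg[of "\<gamma> 0" "\<eta> 0"] by linarith
    moreover have "continuous_on {0..t} (\<lambda>s. d (\<gamma> s) (\<eta> s))"
      using cont t by (auto intro: continuous_on_subset)
    ultimately obtain s where s: "0 \<le> s" "s \<le> t" "d (\<gamma> s) (\<eta> s) = e / 2"
      using IVT'[of "\<lambda>s. d (\<gamma> s) (\<eta> s)" 0 "e / 2" t] t by auto
    then have "d (\<gamma> s) (\<eta> s) < e / 2"
      using eq[of s] close[of s] t \<open>0 < e\<close> by simp
    then show False using s by simp
  qed
  then show ?thesis using eq t by blast
qed

lemma Geo_in_mcball: "\<gamma> \<in> Geo \<Longrightarrow> t \<in> {0..1} \<Longrightarrow> \<gamma> t \<in> mcball (\<gamma> 0) (d (\<gamma> 0) (\<gamma> 1))"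
  using Geo_in_M[of \<gamma> 0] Geo_in_M[of \<gamma> t] Geo_dist[of \<gamma> 0 t]
  by (auto intro: mult_left_le_one_le)

text \<open>Two lifts with the same starting point stay as close to each other as their projections, which
  coincide.\<close>

lemma lift_unique:
  assumes \<gamma>: "\<gamma> \<in> Geo" and \<eta>: "\<eta> \<in> Geo" and start: "\<gamma> 0 = \<eta> 0" and T: "T \<le> 1"
    and eq: "\<And>t. t \<in> {0..T} \<Longrightarrow> q (\<gamma> t) = q (\<eta> t)" and t: "t \<in> {0..T}"
  shows "\<gamma> t = \<eta> t"
proof -
  have "\<gamma> 0 \<in> M" using Geo_in_M[OF \<gamma>] by simp
  then obtain e where e: "e > 0" "\<And>y z. y \<in> mcball (\<gamma> 0) (d (\<gamma> 0) (\<gamma> 1)) \<Longrightarrow> z \<in> M \<Longrightarrow> d y z < e \<Longrightarrow>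
      dq (q y) (q z) = d y z"
    using dq_eq_d_if_close by blast
  have sub: "s \<in> {0..1}" if "s \<in> {0..T}" for s using that T by simp
  have cont: "continuous_map (top_of_set {0..T}) mtopology \<kappa>" if "\<kappa> \<in> Geo" for \<kappa>
    using Geo_continuous_map[OF that] by (rule continuous_map_from_subtopology_mono) (use T in auto)
  have zero: "dq (q (\<gamma> s)) (q (\<eta> s)) = 0" if "s \<in> {0..T}" for s
    using eq[OF that] Geo_in_M[OF \<eta> sub[OF that]] by simp
  have "d (\<gamma> t) (\<eta> t) = dq (q (\<gamma> t)) (q (\<eta> t))"
    using e(2) cont[OF \<gamma>] Geo_in_mcball[OF \<gamma> sub] cont[OF \<eta>] Geo_in_M[OF \<eta> sub] _ _ t
  proof (rule dist_curves_eq_dq)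
    show "d (\<gamma> 0) (\<eta> 0) < e" using start e(1) Geo_in_M[OF \<eta>] by simp
    show "dq (q (\<gamma> s)) (q (\<eta> s)) < e / 2" if "s \<in> {0..T}" for s using zero[OF that] e(1) by simp
  qed
  then show ?thesis using zero[OF t] Geo_in_M[OF \<gamma> sub[OF t]] Geo_in_M[OF \<eta> sub[OF t]] by simp
qed

text \<open>A lift is extended from \<open>T\<close> to \<open>T'\<close> by choosing, for each later time, the point of the
  orbit that is nearest to the end point reached so far. Lengths do not grow, hence the lift stays
  in a fixed ball, so that one bound for \<open>T' - T\<close> serves
  every extension step.\<close>

lemma extend_lift:
  fixes c :: "real \<Rightarrow> 'a set"
  defines "l \<equiv> dq (c 0) (c 1)"
  assumes c: "c \<in> Q.Geo" and x: "x \<in> M"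
    and e: "\<And>y z. y \<in> mcball x l \<Longrightarrow> z \<in> M \<Longrightarrow> d y z < e \<Longrightarrow> dq (q y) (q z) = d y z"
    and \<delta>: "2 * l * (T' - T) < e" "0 \<le> T" "T \<le> T'" "T' \<le> 1"
    and \<gamma>: "\<gamma> 0 = x" "\<And>t. t \<in> {0..T} \<Longrightarrow> \<gamma> t \<in> M \<and> q (\<gamma> t) = c t"
      "\<And>s t. s \<in> {0..T} \<Longrightarrow> t \<in> {0..T} \<Longrightarrow> d (\<gamma> s) (\<gamma> t) \<le> l * \<bar>s - t\<bar>"
  shows "\<exists>\<gamma>'. \<gamma>' 0 = x \<and> (\<forall>t\<in>{0..T'}. \<gamma>' t \<in> M \<and> q (\<gamma>' t) = c t) \<and>
    (\<forall>s\<in>{0..T'}. \<forall>t\<in>{0..T'}. d (\<gamma>' s) (\<gamma>' t) \<le> l * \<bar>s - t\<bar>)"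
proof -
  have l: "0 \<le> l" unfolding l_def by (rule Q.nonneg)
  have T: "\<gamma> T \<in> M" "q (\<gamma> T) = c T" using \<gamma>(2)[of T] \<delta> by auto
  have "\<exists>y. y \<in> M \<and> q y = c t \<and> d (\<gamma> T) y = dq (c T) (c t)" if "t \<in> {0..1}" for t
    using dq_attained[OF T(1) Q.Geo_in_M[OF c that]] T(2) by metis
  then obtain y where y: "\<And>t. t \<in> {0..1} \<Longrightarrow> y t \<in> M \<and> q (y t) = c t \<and> d (\<gamma> T) (y t) = dq (c T) (c t)"
    by metis
  have yT: "d (\<gamma> T) (y t) = l * (t - T)" if "t \<in> {T..T'}" for t
    using y[of t] Q.Geo_dist[OF c, of T t] that \<delta> by (simp add: l_def)
  have yy: "d (y s) (y t) \<le> l * \<bar>s - t\<bar>" if st: "s \<in> {T..T'}" "t \<in> {T..T'}" for s t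
  proof -
    have yM: "y s \<in> M" "y t \<in> M" using y[of s] y[of t] st \<delta> by auto
    have "l * (s - T) \<le> l * (T' - T)" "l * (t - T) \<le> l * (T' - T)"
      using st l by (auto intro: mult_left_mono)
    then have small: "d (y s) (y t) < e"
      using triangle[OF yM(1) T(1) yM(2)] yT[OF st(1)] yT[OF st(2)] \<delta>(1)
      by (simp add: commute algebra_simps)
    have "d x (y s) \<le> d x (\<gamma> T) + d (\<gamma> T) (y s)" by (rule triangle[OF x T(1) yM(1)])
    also have "\<dots> \<le> l * T + l * (s - T)"
      using \<gamma>(3)[of 0 T] \<gamma>(1) \<delta> yT[OF st(1)] by simp
    also have "\<dots> \<le> l" using l st \<delta> by (simp add: algebra_simps mult_left_le)
    finally have "y s \<in> mcball x l" using x yM by simp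
    then have "d (y s) (y t) = dq (c s) (c t)"
      using e[OF _ yM(2) small] y[of s] y[of t] st \<delta> by simp
    then show ?thesis using Q.Geo_dist[OF c, of s t] st \<delta> by (simp add: l_def mult.commute)
  qed
  define \<gamma>' where "\<gamma>' t = (if t \<le> T then \<gamma> t else y t)" for t
  have mixed: "d (\<gamma>' s) (\<gamma>' t) \<le> l * (t - s)" if st: "0 \<le> s" "s \<le> t" "t \<le> T'" for s t
  proof -
    consider "t \<le> T" | "T < s" | "s \<le> T" "T < t" by linarith
    then show ?thesis
    proof cases
      case 1 then show ?thesis using \<gamma>(3)[of s t] st by (simp add: \<gamma>'_def)
    next
      case 2 then show ?thesis using yy[of s t] st by (simp add: \<gamma>'_def)
    next
      case 3
      have "d (\<gamma> s) (y t) \<le> d (\<gamma> s) (\<gamma> T) + d (\<gamma> T) (y t)"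
        using \<gamma>(2)[of s] y[of t] st \<delta> 3 T by (intro triangle) auto
      also have "\<dots> \<le> l * (T - s) + l * (t - T)"
        using \<gamma>(3)[of s T] yT[of t] 3 st \<delta> by simp
      finally show ?thesis using 3 by (simp add: \<gamma>'_def algebra_simps)
    qed
  qed
  have "\<gamma>' t \<in> M \<and> q (\<gamma>' t) = c t" if "t \<in> {0..T'}" for t
    using \<gamma>(2)[of t] y[of t] that \<delta> by (simp add: \<gamma>'_def)
  moreover have "d (\<gamma>' s) (\<gamma>' t) \<le> l * \<bar>s - t\<bar>" if "s \<in> {0..T'}" "t \<in> {0..T'}" for s t
    using mixed[of s t] mixed[of t s] that by (cases "s \<le> t") (auto simp: commute)
  moreover have "\<gamma>' 0 = x" using \<gamma>(1) \<delta> by (simp add: \<gamma>'_def)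
  ultimately show ?thesis by blast
qed

text \<open>Repeated extension reaches time \<open>1\<close>. The resulting curve is a geodesic because \<open>q\<close> does not increase
  distances: it can be no shorter than its projection between any two times.\<close>

lemma exists_lift:
  assumes c: "c \<in> Q.Geo" and x: "x \<in> M" "q x = c 0"
  shows "\<exists>\<gamma>\<in>Geo. \<gamma> 0 = x \<and> d (\<gamma> 0) (\<gamma> 1) = dq (c 0) (c 1) \<and> (\<forall>t\<in>{0..1}. q (\<gamma> t) = c t)"
proof -
  let ?l = "dq (c 0) (c 1)"
  obtain e where e: "e > 0" "\<And>y z. y \<in> mcball x ?l \<Longrightarrow> z \<in> M \<Longrightarrow> d y z < e \<Longrightarrow>
      dq (q y) (q z) = d y z"
    using dq_eq_d_if_close[OF x(1)] by blast
  define \<delta> where "\<delta> = e / (2 * ?l + 1)"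
  have l: "0 \<le> ?l" by (rule Q.nonneg)
  then have pos: "0 < 2 * ?l + 1" by linarith
  then have "0 < \<delta>" "\<delta> * (2 * ?l + 1) = e"
    using e(1) by (simp_all add: \<delta>_def)
  then have \<delta>: "0 < \<delta>" "2 * ?l * \<delta> < e"
    by (simp_all add: algebra_simps)
  have step: "\<exists>\<gamma>. \<gamma> 0 = x \<and> (\<forall>t\<in>{0..min 1 (real n * \<delta>)}. \<gamma> t \<in> M \<and> q (\<gamma> t) = c t) \<and>
    (\<forall>s\<in>{0..min 1 (real n * \<delta>)}. \<forall>t\<in>{0..min 1 (real n * \<delta>)}. d (\<gamma> s) (\<gamma> t) \<le> ?l * \<bar>s - t\<bar>)" for n
  proof (induction n)
    case 0
    then show ?case using x by (intro exI[of _ "\<lambda>_. x"]) auto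
  next
    case (Suc n)
    let ?T = "min 1 (real n * \<delta>)" and ?T' = "min 1 (real (Suc n) * \<delta>)"
    obtain \<gamma> where \<gamma>: "\<gamma> 0 = x" "\<forall>t\<in>{0..?T}. \<gamma> t \<in> M \<and> q (\<gamma> t) = c t"
      "\<forall>s\<in>{0..?T}. \<forall>t\<in>{0..?T}. d (\<gamma> s) (\<gamma> t) \<le> ?l * \<bar>s - t\<bar>"
      using Suc.IH by blast
    have T: "0 \<le> ?T" "?T \<le> ?T'" "?T' \<le> 1" "?T' - ?T \<le> \<delta>"
      using \<delta>(1) by (auto simp: min_def algebra_simps)
    have "2 * ?l * (?T' - ?T) \<le> 2 * ?l * \<delta>" using T(4) l by (intro mult_left_mono) auto
    then have small: "2 * ?l * (?T' - ?T) < e" using \<delta>(2) by linarith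
    show ?case
      by (rule extend_lift[OF c x(1) e(2) small T(1-3) \<gamma>(1) bspec[OF \<gamma>(2)] bspec[OF bspec[OF \<gamma>(3)]]])
  qed
  obtain n :: nat where "1 / \<delta> \<le> real n" using real_arch_simple by blast
  then have "min 1 (real n * \<delta>) = 1" using \<delta>(1) by (simp add: divide_simps min_def)
  then obtain \<gamma> where \<gamma>: "\<gamma> 0 = x" "\<And>t. t \<in> {0..1} \<Longrightarrow> \<gamma> t \<in> M \<and> q (\<gamma> t) = c t"
    "\<And>s t. s \<in> {0..1} \<Longrightarrow> t \<in> {0..1} \<Longrightarrow> d (\<gamma> s) (\<gamma> t) \<le> ?l * \<bar>s - t\<bar>"
    using step[of n] by (metis (no_types, lifting))
  have *: "d (\<gamma> s) (\<gamma> t) = \<bar>s - t\<bar> * ?l" if st: "s \<in> {0..1}" "t \<in> {0..1}" for s t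
    using \<gamma>(3)[OF st] dq_le[of "\<gamma> s" "\<gamma> t"] \<gamma>(2)[OF st(1)] \<gamma>(2)[OF st(2)] Q.Geo_dist[OF c st]
    by (simp add: mult.commute)
  have "restrict \<gamma> {0..1} \<in> Geo"
    unfolding Geo_iff using \<gamma>(2) * by simp
  then show ?thesis
    using \<gamma>(1,2) *[of 0 1] by (intro bexI[of _ "restrict \<gamma> {0..1}"]) auto
qed

definition lift :: "(real \<Rightarrow> 'a set) \<Rightarrow> real \<Rightarrow> 'a" where
  "lift c = (SOME \<gamma>. \<gamma> \<in> Geo \<and> \<gamma> 0 = sect (c 0) \<and> d (\<gamma> 0) (\<gamma> 1) = dq (c 0) (c 1) \<and>
    (\<forall>t\<in>{0..1}. q (\<gamma> t) = c t))"

lemma lift: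
  assumes "c \<in> Q.Geo"
  shows "lift c \<in> Geo" "lift c 0 = sect (c 0)" "d (lift c 0) (lift c 1) = dq (c 0) (c 1)"
    "t \<in> {0..1} \<Longrightarrow> q (lift c t) = c t"
proof -
  have "c 0 \<in> Mq" using Q.Geo_in_M[OF assms] by simp
  then have "\<exists>\<gamma>. \<gamma> \<in> Geo \<and> \<gamma> 0 = sect (c 0) \<and> d (\<gamma> 0) (\<gamma> 1) = dq (c 0) (c 1) \<and>
      (\<forall>t\<in>{0..1}. q (\<gamma> t) = c t)"
    using exists_lift[OF assms sect(3,2)] by blast
  from someI_ex[OF this] show "lift c \<in> Geo" "lift c 0 = sect (c 0)"
    "d (lift c 0) (lift c 1) = dq (c 0) (c 1)" "t \<in> {0..1} \<Longrightarrow> q (lift c t) = c t"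
    unfolding lift_def by blast+
qed

text \<open>Only the starting point depends discontinuously on the geodesic. As long as it stays in one sheet,
  lifts of nearby geodesics start close together and then remain close.\<close>

lemma measurable_lift: "lift \<in> borel_of Q.Geo_topology \<rightarrow>\<^sub>M borel_of Geo_topology"
proof -
  interpret QM: Metric_space12 Mq dq M d ..
  let ?A = "\<lambda>n. (\<lambda>c. c 0) -` piece n \<inter> Q.Geo"
  have "continuous_map (subtopology Q.Geo_topology (?A n)) Geo_topology lift" for n
  proof (rule QM.continuous_map_Geo)
    show "lift c \<in> Geo" if "c \<in> Q.Geo" for c using that by (rule lift)
    fix c and \<epsilon> :: real assume c: "c \<in> Q.Geo" "c \<in> ?A n" and \<epsilon>: "0 < \<epsilon>"
    have l: "lift c \<in> Geo" using c(1) by (rule lift)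
    have "lift c 0 \<in> M" using Geo_in_M[OF l] by simp
    then obtain e where e: "e > 0"
      "\<And>y z. y \<in> mcball (lift c 0) (d (lift c 0) (lift c 1)) \<Longrightarrow> z \<in> M \<Longrightarrow> d y z < e \<Longrightarrow>
        dq (q y) (q z) = d y z"
      using dq_eq_d_if_close by blast
    define \<delta> where "\<delta> = min \<epsilon> (e / 2)"
    have \<delta>: "0 < \<delta>" "\<delta> \<le> \<epsilon>" "\<delta> \<le> e / 2" using e(1) \<epsilon> by (auto simp: \<delta>_def)
    have "d (lift c t) (lift c' t) < \<epsilon>"
      if c': "c' \<in> Q.Geo" "c' \<in> ?A n" "\<forall>t\<in>{0..1}. dq (c t) (c' t) < \<delta>" and t: "t \<in> {0..1}" for c' t
    proof -
      have l': "lift c' \<in> Geo" using c'(1) by (rule lift)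
      have close: "dq (q (lift c s)) (q (lift c' s)) < \<delta>" if "s \<in> {0..1}" for s
        using c'(3) lift(4)[OF c(1) that] lift(4)[OF c'(1) that] that by simp
      \<comment> \<open>Both lifts start in the same sheet, on which \<open>q\<close> is an isometry.\<close>
      have idx: "c 0 \<in> Mq" "c' 0 \<in> Mq" "sheet_index (c 0) = n" "sheet_index (c' 0) = n"
        using c c' by (auto simp: piece_def)
      have "lift c 0 \<in> sheet n" "lift c' 0 \<in> sheet n"
        using sect(1)[OF idx(1)] sect(1)[OF idx(2)] idx lift(2)[OF c(1)] lift(2)[OF c'(1)] by simp_all
      then have "d (lift c 0) (lift c' 0) = dq (q (lift c 0)) (q (lift c' 0))"
        using sheet(2)[of n] unfolding isometric_on_def by simp
      then have start: "d (lift c 0) (lift c' 0) < e" using close[of 0] \<delta> e(1) by simp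
      have "d (lift c t) (lift c' t) = dq (q (lift c t)) (q (lift c' t))"
        using e(2) Geo_continuous_map[OF l] Geo_in_mcball[OF l] Geo_continuous_map[OF l']
          Geo_in_M[OF l'] start _ t
      proof (rule dist_curves_eq_dq)
        show "dq (q (lift c s)) (q (lift c' s)) < e / 2" if "s \<in> {0..1}" for s
          using close[OF that] \<delta> by simp
      qed
      then show ?thesis using close[OF t] \<delta> by simp
    qed
    then show "\<exists>\<delta>>0. \<forall>c'\<in>Q.Geo \<inter> ?A n. (\<forall>t\<in>{0..1}. dq (c t) (c' t) < \<delta>) \<longrightarrow>
        (\<forall>t\<in>{0..1}. d (lift c t) (lift c' t) < \<epsilon>)"
      using \<delta>(1) by blast
  qed
  moreover have "?A n \<in> sets (borel_of Q.Geo_topology)" for n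
    using measurable_sets[OF Q.measurable_eval piece_measurable, of 0 n] by simp
  moreover have "(\<Union>n. ?A n) = topspace Q.Geo_topology"
  proof (intro equalityI subsetI)
    fix c assume "c \<in> topspace Q.Geo_topology"
    then have c: "c \<in> Q.Geo" by simp
    then have "c 0 \<in> (\<Union>n. piece n)" unfolding UN_piece using Q.Geo_in_M by simp
    with c show "c \<in> (\<Union>n. ?A n)" by blast
  qed auto
  ultimately show ?thesis
    by (intro measurable_piecewise_continuous[of UNIV ?A]) simp_all
qed

section \<open>Essential non-branching of the quotient\<close>

lemma compactin_mcball: "compactin mtopology (mcball x r)"
  using proper[of x r] mcball_eq_empty[of x r] by (cases "x \<in> M") auto

lemma finite_fibre_mcball: "finite {y \<in> mcball x r. q y = Y}"
proof (cases "{y \<in> mcball x r. q y = Y} = {}")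
  case False
  then obtain y0 where y0: "y0 \<in> mcball x r" "q y0 = Y" by blast
  have "{y \<in> mcball x r. q y = Y} \<subseteq> (\<lambda>g. \<phi> g y0) ` {g \<in> carrier G. d y0 (\<phi> g y0) \<le> 2 * r}"
  proof
    fix y assume "y \<in> {y \<in> mcball x r. q y = Y}"
    then have y: "y \<in> mcball x r" "q y0 = q y" using y0 by auto
    then obtain g where g: "g \<in> carrier G" "\<phi> g y0 = y" using q_eq_iff[of y0 y] y0 by auto
    have "d y0 y \<le> 2 * r" using triangle[of y0 x y] y y0 by (simp add: commute)
    then show "y \<in> (\<lambda>g. \<phi> g y0) ` {g \<in> carrier G. d y0 (\<phi> g y0) \<le> 2 * r}" using g by blast
  qed
  moreover have "finite {g \<in> carrier G. d y0 (\<phi> g y0) \<le> 2 * r}"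
    using y0 by (intro finite_return) simp
  ultimately show ?thesis by (meson finite_imageI finite_subset)
next
  case True
  then show ?thesis by (simp only: finite.emptyI)
qed

text \<open>A compact set is covered by the images of finitely many sheets, and the section takes values in the
  first sheet possible.\<close>

lemma sect_bounded_on_compact:
  assumes K: "compactin Q.mtopology K"
  shows "\<exists>x r. sect ` K \<subseteq> mcball x r"
proof -
  have KM: "K \<subseteq> Mq" using compactin_subset_topspace[OF K] by simp
  have "K \<subseteq> (\<Union>n. q ` sheet n)" using KM sheet_index by blast
  moreover have "openin Q.mtopology U" if "U \<in> range (\<lambda>n. q ` sheet n)" for U
    using that openin_q_sheet by blast
  ultimately obtain F where F: "finite F" "F \<subseteq> range (\<lambda>n. q ` sheet n)" "K \<subseteq> \<Union>F"
    using compactinD[OF K, of "range (\<lambda>n. q ` sheet n)"] by blast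
  then obtain I where I: "finite I" "F = (\<lambda>n. q ` sheet n) ` I"
    by (meson finite_subset_image)
  have "sect ` K \<subseteq> (\<Union>n\<le>Max I. sheet n)"
  proof
    fix y assume "y \<in> sect ` K"
    then obtain X where X: "X \<in> K" "y = sect X" by blast
    then obtain n where n: "n \<in> I" "X \<in> q ` sheet n" using F(3) I by blast
    have "sheet_index X \<le> n" unfolding sheet_index_def by (rule Least_le) (rule n(2))
    also have "n \<le> Max I" using I(1) n(1) by simp
    finally show "y \<in> (\<Union>n\<le>Max I. sheet n)" using sect(1)[of X] X KM by blast
  qed
  moreover have "mbounded (\<Union>n\<le>Max I. sheet n)"
    by (rule mbounded_Union) (use sheet(3) in auto)
  ultimately show ?thesis unfolding mbounded_def by (meson order_trans)
qed

lemma measurable_pair_q: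
  "(\<lambda>(x, y). (q x, q y)) \<in> mborel \<Otimes>\<^sub>M mborel \<rightarrow>\<^sub>M Q.mborel \<Otimes>\<^sub>M Q.mborel"
  using measurable_q by measurable

text \<open>Lifting preserves the cost, and projecting does not increase it.\<close>

lemma lift_optimal:
  assumes \<nu>: "\<nu> \<in> Q.OptGeo \<mu>0 \<mu>1"
  defines "\<nu>' \<equiv> distr \<nu> (borel_of Geo_topology) lift"
  shows "\<nu>' \<in> OptGeo (distr \<mu>0 mborel sect) (distr \<nu>' mborel (\<lambda>\<gamma>. \<gamma> 1))"
proof -
  note mg = Q.OptGeo_marginals[OF \<nu>]
  let ?\<mu>0 = "distr \<mu>0 mborel sect" and ?\<mu>1 = "distr \<nu>' mborel (\<lambda>\<gamma>. \<gamma> 1)"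
  have li: "lift \<in> \<nu> \<rightarrow>\<^sub>M borel_of Geo_topology"
    using measurable_lift by (simp add: measurable_cong_sets[OF mg(1) refl])
  have sp: "space \<nu> = Q.Geo" using sets_eq_imp_space_eq[OF mg(1)] by simp
  have ev: "(\<lambda>c. c t) \<in> \<nu> \<rightarrow>\<^sub>M Q.mborel" if "t \<in> {0..1}" for t
    using Q.measurable_eval[OF that] by (simp add: measurable_cong_sets[OF mg(1) refl])
  have sets': "sets \<nu>' = sets (borel_of Geo_topology)" by (simp add: \<nu>'_def)
  have ev': "(\<lambda>c. c t) \<in> \<nu>' \<rightarrow>\<^sub>M mborel" if "t \<in> {0..1}" for t
    using measurable_eval[OF that] by (simp add: measurable_cong_sets[OF sets' refl])
  have prob: "prob_space \<nu>'" unfolding \<nu>'_def using mg(2) li by (rule prob_space.prob_space_distr)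
  have m0: "distr \<nu>' mborel (\<lambda>\<gamma>. \<gamma> 0) = ?\<mu>0"
  proof -
    have "distr \<nu>' mborel (\<lambda>\<gamma>. \<gamma> 0) = distr \<nu> mborel (\<lambda>c. lift c 0)"
      unfolding \<nu>'_def by (subst distr_distr[OF measurable_eval li]) (simp_all add: comp_def)
    also have "\<dots> = distr \<nu> mborel (\<lambda>c. sect (c 0))"
      by (rule distr_cong) (simp_all add: sp lift)
    also have "\<dots> = distr (distr \<nu> Q.mborel (\<lambda>c. c 0)) mborel sect"
      by (subst distr_distr[OF measurable_sect ev]) (simp_all add: comp_def)
    finally show ?thesis by (simp add: mg(3))
  qed
  have q0: "distr ?\<mu>0 Q.mborel q = \<mu>0"
  proof -
    have "sets \<mu>0 = sets Q.mborel" unfolding mg(3)[symmetric] by simp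
    moreover from this have "sect \<in> \<mu>0 \<rightarrow>\<^sub>M mborel"
      using measurable_sect by (simp cong: measurable_cong_sets)
    moreover have "space \<mu>0 = Mq" using sets_eq_imp_space_eq[OF calculation(1)] by simp
    ultimately have "distr ?\<mu>0 Q.mborel q = distr \<mu>0 Q.mborel (q \<circ> sect)"
      and "distr \<mu>0 Q.mborel (q \<circ> sect) = distr \<mu>0 \<mu>0 (\<lambda>x. x)"
      by (simp add: distr_distr[OF measurable_q], intro distr_cong) (simp_all add: sect)
    then show ?thesis by (simp add: distr_id)
  qed
  have q1: "distr ?\<mu>1 Q.mborel q = \<mu>1"
  proof -
    have "distr ?\<mu>1 Q.mborel q = distr \<nu>' Q.mborel (\<lambda>\<gamma>. q (\<gamma> 1))"
      by (subst distr_distr[OF measurable_q ev']) (simp_all add: comp_def)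
    also have "\<dots> = distr \<nu> Q.mborel (\<lambda>c. q (lift c 1))"
      unfolding \<nu>'_def
      by (subst distr_distr[OF measurable_compose[OF measurable_eval measurable_q] li])
        (simp_all add: comp_def)
    also have "\<dots> = distr \<nu> Q.mborel (\<lambda>c. c 1)"
      by (rule distr_cong) (simp_all add: sp lift)
    finally show ?thesis by (simp add: mg(4))
  qed
  let ?\<pi> = "distr \<nu>' (mborel \<Otimes>\<^sub>M mborel) (\<lambda>\<gamma>. (\<gamma> 0, \<gamma> 1))"
  let ?\<pi>q = "distr \<nu> (Q.mborel \<Otimes>\<^sub>M Q.mborel) (\<lambda>\<gamma>. (\<gamma> 0, \<gamma> 1))"
  have md: "(\<lambda>(x, y). ennreal ((d x y)\<^sup>2)) \<in> borel_measurable (mborel \<Otimes>\<^sub>M mborel)"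
    by (rule measurable_dist_pair[OF separable])
  have mdq: "(\<lambda>(x, y). ennreal ((dq x y)\<^sup>2)) \<in> borel_measurable (Q.mborel \<Otimes>\<^sub>M Q.mborel)"
    by (rule Q.measurable_dist_pair[OF Q_separable])
  have ends: "(\<lambda>\<gamma>. (\<gamma> 0, \<gamma> 1)) \<in> \<nu>' \<rightarrow>\<^sub>M mborel \<Otimes>\<^sub>M mborel"
    using measurable_endpoints by (simp add: measurable_cong_sets[OF sets' refl])
  have endsq: "(\<lambda>\<gamma>. (\<gamma> 0, \<gamma> 1)) \<in> \<nu> \<rightarrow>\<^sub>M Q.mborel \<Otimes>\<^sub>M Q.mborel"
    using Q.measurable_endpoints by (simp add: measurable_cong_sets[OF mg(1) refl])
  have "(\<integral>\<^sup>+ (x, y). ennreal ((d x y)\<^sup>2) \<partial>?\<pi>) = (\<integral>\<^sup>+ \<gamma>. ennreal ((d (\<gamma> 0) (\<gamma> 1))\<^sup>2) \<partial>\<nu>')"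
    by (subst nn_integral_distr[OF ends]) (simp_all add: md)
  also have "\<dots> = (\<integral>\<^sup>+ c. ennreal ((d (lift c 0) (lift c 1))\<^sup>2) \<partial>\<nu>)"
    unfolding \<nu>'_def
  proof (rule nn_integral_distr[OF li])
    show "(\<lambda>\<gamma>. ennreal ((d (\<gamma> 0) (\<gamma> 1))\<^sup>2))
        \<in> borel_measurable (distr \<nu> (borel_of Geo_topology) lift)"
      using measurable_compose[OF measurable_endpoints md] by simp
  qed
  also have "\<dots> = (\<integral>\<^sup>+ c. ennreal ((dq (c 0) (c 1))\<^sup>2) \<partial>\<nu>)"
    by (rule nn_integral_cong) (simp add: sp lift(3))
  also have "\<dots> = (\<integral>\<^sup>+ (x, y). ennreal ((dq x y)\<^sup>2) \<partial>?\<pi>q)"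
    by (subst nn_integral_distr[OF endsq]) (simp_all add: mdq)
  finally have cost: "(\<integral>\<^sup>+ (x, y). ennreal ((d x y)\<^sup>2) \<partial>?\<pi>) =
      (\<integral>\<^sup>+ (x, y). ennreal ((dq x y)\<^sup>2) \<partial>?\<pi>q)" .
  have "(\<integral>\<^sup>+ (x, y). ennreal ((d x y)\<^sup>2) \<partial>?\<pi>) \<le> (\<integral>\<^sup>+ (x, y). ennreal ((d x y)\<^sup>2) \<partial>\<pi>)"
    if "\<pi> \<in> couplings ?\<mu>0 ?\<mu>1" for \<pi>
  proof -
    have \<pi>: "sets \<pi> = sets (mborel \<Otimes>\<^sub>M mborel)" "distr \<pi> mborel fst = ?\<mu>0"
      "distr \<pi> mborel snd = ?\<mu>1"
      using that by (simp_all add: couplings_def)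
    have sp\<pi>: "space \<pi> = M \<times> M"
      using sets_eq_imp_space_eq[OF \<pi>(1)] by (simp add: space_pair_measure)
    have mp: "(\<lambda>(x, y). (q x, q y)) \<in> \<pi> \<rightarrow>\<^sub>M Q.mborel \<Otimes>\<^sub>M Q.mborel"
      using measurable_pair_q by (simp add: measurable_cong_sets[OF \<pi>(1) refl])
    have fst: "fst \<in> \<pi> \<rightarrow>\<^sub>M mborel" and snd: "snd \<in> \<pi> \<rightarrow>\<^sub>M mborel"
      by (simp_all add: measurable_cong_sets[OF \<pi>(1) refl])
    let ?\<pi>' = "distr \<pi> (Q.mborel \<Otimes>\<^sub>M Q.mborel) (\<lambda>(x, y). (q x, q y))"
    have "distr ?\<pi>' Q.mborel fst = distr \<pi> Q.mborel (\<lambda>z. q (fst z))"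
      by (subst distr_distr[OF measurable_fst mp]) (simp add: comp_def split_beta')
    also have "\<dots> = distr (distr \<pi> mborel fst) Q.mborel q"
      by (subst distr_distr[OF measurable_q fst]) (simp add: comp_def)
    also have "\<dots> = \<mu>0" by (simp add: \<pi>(2) q0)
    finally have 1: "distr ?\<pi>' Q.mborel fst = \<mu>0" .
    have "distr ?\<pi>' Q.mborel snd = distr \<pi> Q.mborel (\<lambda>z. q (snd z))"
      by (subst distr_distr[OF measurable_snd mp]) (simp add: comp_def split_beta')
    also have "\<dots> = distr (distr \<pi> mborel snd) Q.mborel q"
      by (subst distr_distr[OF measurable_q snd]) (simp add: comp_def)
    also have "\<dots> = \<mu>1" by (simp add: \<pi>(3) q1)
    finally have 2: "distr ?\<pi>' Q.mborel snd = \<mu>1" .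
    have "?\<pi>' \<in> Q.couplings \<mu>0 \<mu>1" using 1 2 by (simp add: Q.couplings_def)
    then have "(\<integral>\<^sup>+ (x, y). ennreal ((dq x y)\<^sup>2) \<partial>?\<pi>q) \<le> (\<integral>\<^sup>+ (x, y). ennreal ((dq x y)\<^sup>2) \<partial>?\<pi>')"
      using \<nu> unfolding Q.OptGeo_def Q.optimal_couplings_def by blast
    also have "\<dots> = (\<integral>\<^sup>+ (x, y). ennreal ((dq (q x) (q y))\<^sup>2) \<partial>\<pi>)"
      by (subst nn_integral_distr[OF mp]) (use mdq in \<open>simp_all add: split_beta'\<close>)
    also have "\<dots> \<le> (\<integral>\<^sup>+ (x, y). ennreal ((d x y)\<^sup>2) \<partial>\<pi>)"
      by (rule nn_integral_mono) (auto simp: sp\<pi> intro!: ennreal_leI power_mono dq_le)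
    finally show ?thesis unfolding cost .
  qed
  then show ?thesis
    using endpoint_coupling[OF sets' m0 refl] sets' prob
    by (simp add: OptGeo_def optimal_couplings_def)
qed

theorem Q_delta_essentially_non_branching:
  assumes enb: delta_essentially_non_branching
  shows Q.delta_essentially_non_branching
  unfolding Q.delta_essentially_non_branching_def
proof (intro ballI allI impI)
  fix \<mu>0 \<mu>1 \<nu>
  assume \<mu>0: "\<mu>0 \<in> Q.Pc" and ac: "absolutely_continuous mq \<mu>0 \<and> Q.finite_dirac_sum \<mu>1"
    and \<nu>: "\<nu> \<in> Q.OptGeo \<mu>0 \<mu>1"
  note mg = Q.OptGeo_marginals[OF \<nu>]
  define \<nu>' where "\<nu>' = distr \<nu> (borel_of Geo_topology) lift"
  let ?\<mu>0 = "distr \<mu>0 mborel sect" and ?\<mu>1 = "distr \<nu>' mborel (\<lambda>\<gamma>. \<gamma> 1)"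
  have li: "lift \<in> \<nu> \<rightarrow>\<^sub>M borel_of Geo_topology"
    using measurable_lift by (simp add: measurable_cong_sets[OF mg(1) refl])
  have sp: "space \<nu> = Q.Geo" using sets_eq_imp_space_eq[OF mg(1)] by simp
  have ev: "(\<lambda>c. c t) \<in> \<nu> \<rightarrow>\<^sub>M Q.mborel" if "t \<in> {0..1}" for t
    using Q.measurable_eval[OF that] by (simp add: measurable_cong_sets[OF mg(1) refl])
  have s0: "sets \<mu>0 = sets Q.mborel" "prob_space \<mu>0" "compactin Q.mtopology (Q.msupport \<mu>0)"
    using \<mu>0 by (auto simp: Q.Pc_def)
  have sp0: "space \<mu>0 = Mq" using sets_eq_imp_space_eq[OF s0(1)] by simp
  have se: "sect \<in> \<mu>0 \<rightarrow>\<^sub>M mborel"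
    using measurable_sect by (simp add: measurable_cong_sets[OF s0(1) refl])
  obtain x r where xr: "sect ` Q.msupport \<mu>0 \<subseteq> mcball x r"
    using sect_bounded_on_compact[OF s0(3)] by blast
  have "AE X in \<mu>0. X \<in> Q.msupport \<mu>0"
    by (rule Q.AE_msupport[OF Q.second_countable_mtopology[OF Q_separable] s0(1)])
  then have AE0: "AE X in \<mu>0. sect X \<in> mcball x r" by (rule eventually_mono) (use xr in blast)
  have "?\<mu>0 \<in> Pc"
  proof -
    have "{y \<in> space mborel. y \<in> mcball x r} = mcball x r"
      using mcball_subset_mspace by auto
    then have "{y \<in> space mborel. y \<in> mcball x r} \<in> sets mborel"
      using closedin_mborel[OF closedin_mcball] by metis
    then have "AE y in ?\<mu>0. y \<in> mcball x r"
      using AE0 AE_distr_iff[OF se, of "\<lambda>y. y \<in> mcball x r"] by blast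
    then have "compactin mtopology (msupport ?\<mu>0)"
      by (rule compactin_msupport[OF _ compactin_mcball]) simp
    then show ?thesis
      using prob_space.prob_space_distr[OF s0(2) se] by (simp add: Pc_def)
  qed
  moreover have "absolutely_continuous m ?\<mu>0"
    unfolding absolutely_continuous_def
  proof
    fix E assume E: "E \<in> null_sets m"
    then have Em: "E \<in> sets mborel" using borel by auto
    let ?E = "sect -` E \<inter> Mq"
    have "?E \<in> sets Q.mborel" using measurable_sets[OF measurable_sect Em] by simp
    moreover have "emeasure m (fund \<inter> q -` ?E) \<le> emeasure m E"
      using E by (intro emeasure_mono) (auto simp: fund_def)
    ultimately have "?E \<in> null_sets mq" using E by (simp add: null_sets_def emeasure_mq)
    then have "?E \<in> null_sets \<mu>0" using ac by (auto simp: absolutely_continuous_def)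
    then show "E \<in> null_sets ?\<mu>0"
      using Em by (simp add: null_sets_def emeasure_distr[OF se] sp0)
  qed
  moreover have "finite_dirac_sum ?\<mu>1"
  proof -
    obtain F where F: "F \<subseteq> Mq" "finite F" "AE X in \<mu>1. X \<in> F"
      using Q.AE_finite_if_finite_dirac_sum ac by blast
    \<comment> \<open>Lifts start in a bounded set and have bounded lengths; hence they end in a bounded part of
      finitely many orbits, which is finite.\<close>
    define R where "R = 2 * r + Max (insert 0 (dq (q x) ` F))"
    let ?F = "\<Union>Y\<in>F. {y \<in> mcball x R. q y = Y}"
    have fin: "finite ?F" using F(2) finite_fibre_mcball by blast
    have FM: "?F \<subseteq> M" by auto
    have "AE c in \<nu>. sect (c 0) \<in> mcball x r"
      using AE0 unfolding mg(3)[symmetric] by (rule AE_distrD[OF ev, rotated]) simp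
    moreover have "AE c in \<nu>. c 1 \<in> F"
      using F(3) unfolding mg(4)[symmetric] by (rule AE_distrD[OF ev, rotated]) simp
    moreover have "AE c in \<nu>. c \<in> Q.Geo" by (rule AE_I2) (simp add: sp)
    ultimately have AE1: "AE c in \<nu>. lift c 1 \<in> ?F"
    proof eventually_elim
      case (elim c)
      have l: "lift c 0 \<in> M" "lift c 1 \<in> M" and x: "x \<in> M" "d x (lift c 0) \<le> r"
        using Geo_in_M[OF lift(1)[OF elim(3)]] elim lift(2)[OF elim(3)] by auto
      have c: "c 0 = q (lift c 0)" "c 1 = q (lift c 1)" using lift(4)[OF elim(3)] by simp_all
      have "d x (lift c 1) \<le> d x (lift c 0) + dq (c 0) (c 1)"
        using triangle[OF x(1) l] lift(3)[OF elim(3)] by simp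
      also have "dq (c 0) (c 1) \<le> dq (c 0) (q x) + dq (q x) (c 1)"
        using Q.Geo_in_M[OF elim(3)] x by (intro Q.triangle) auto
      also have "dq (c 0) (q x) \<le> r"
        using dq_le[OF l(1) x(1)] x(2) by (simp add: c(1) commute)
      also have "dq (q x) (c 1) \<le> Max (insert 0 (dq (q x) ` F))"
        using F(2) elim(2) by (intro Max_ge) auto
      finally have "d x (lift c 1) \<le> R" using x(2) by (simp add: R_def)
      then show ?case using elim(2) l x c by auto
    qed
    have m1: "(\<lambda>c. lift c 1) \<in> \<nu> \<rightarrow>\<^sub>M mborel"
      by (rule measurable_compose[OF li measurable_eval]) simp
    have \<mu>1: "?\<mu>1 = distr \<nu> mborel (\<lambda>c. lift c 1)"
      unfolding \<nu>'_def by (subst distr_distr[OF measurable_eval li]) (simp_all add: comp_def)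
    have "?F \<in> sets mborel" using fin FM by (rule finite_mborel)
    then have "{y \<in> space mborel. y \<in> ?F} \<in> sets mborel"
      using FM by (metis Int_absorb1 Int_def space_mborel)
    then have "AE y in ?\<mu>1. y \<in> ?F"
      unfolding \<mu>1 using AE1 AE_distr_iff[OF m1, of "\<lambda>y. y \<in> ?F"] by blast
    then show ?thesis
      using fin FM prob_space.prob_space_distr[OF mg(2) m1] \<mu>1
      by (intro finite_dirac_sum_if_AE_finite[of _ ?F]) simp_all
  qed
  moreover have "\<nu>' \<in> OptGeo ?\<mu>0 ?\<mu>1"
    unfolding \<nu>'_def by (rule lift_optimal[OF \<nu>])
  ultimately obtain \<Gamma> where \<Gamma>: "\<Gamma> \<subseteq> Geo" "non_branching \<Gamma>" "AE \<gamma> in \<nu>'. \<gamma> \<in> \<Gamma>"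
    using enb unfolding delta_essentially_non_branching_def by blast
  let ?\<Gamma> = "{c \<in> Q.Geo. lift c \<in> \<Gamma>}"
  have "AE c in \<nu>. lift c \<in> \<Gamma>" using \<Gamma>(3) unfolding \<nu>'_def by (rule AE_distrD[OF li])
  then have "AE c in \<nu>. c \<in> ?\<Gamma>"
    using AE_space by eventually_elim (simp add: sp)
  moreover have "Q.non_branching ?\<Gamma>"
    unfolding Q.non_branching_def
  proof (intro ballI impI)
    fix c c' assume c: "c \<in> ?\<Gamma>" "c' \<in> ?\<Gamma>" and "\<exists>t\<in>{0<..<1}. \<forall>s\<in>{0..t}. c s = c' s"
    then obtain t where t: "0 < t" "t < 1" "\<And>s. s \<in> {0..t} \<Longrightarrow> c s = c' s" by auto
    have Geo: "c \<in> Q.Geo" "c' \<in> Q.Geo" using c by auto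
    have "lift c s = lift c' s" if s: "s \<in> {0..t}" for s
    proof (rule lift_unique[OF lift(1)[OF Geo(1)] lift(1)[OF Geo(2)] _ _ _ s])
      show "lift c 0 = lift c' 0" using lift(2) Geo t(1) t(3)[of 0] by simp
      show "q (lift c u) = q (lift c' u)" if "u \<in> {0..t}" for u
        using lift(4)[OF Geo(1), of u] lift(4)[OF Geo(2), of u] t(2) t(3)[OF that] that by simp
    qed (use t in simp)
    then have agree: "\<exists>t\<in>{0<..<1}. \<forall>s\<in>{0..t}. lift c s = lift c' s"
      using t(1,2) by (intro bexI[of _ t] ballI) simp_all
    have "lift c \<in> \<Gamma>" "lift c' \<in> \<Gamma>" using c by simp_all
    then have "lift c = lift c'"
      by (rule \<Gamma>(2)[unfolded non_branching_def, THEN bspec, THEN bspec, THEN mp, OF _ _ agree])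
    then have eq: "c s = c' s" if "s \<in> {0..1}" for s
      using lift(4)[OF Geo(1) that] lift(4)[OF Geo(2) that] by simp
    have "c \<in> extensional {0..1}" "c' \<in> extensional {0..1}"
      using Geo unfolding Q.Geo_iff by blast+
    then show "c = c'" using eq by (rule extensionalityI)
  qed
  ultimately show "\<exists>\<Gamma>\<subseteq>Q.Geo. Q.non_branching \<Gamma> \<and> (AE c in \<nu>. c \<in> \<Gamma>)"
    by (intro exI[of _ ?\<Gamma>]) auto
qed

end

theorem theorem1p4:
  fixes M :: "'a set" and d :: "'a \<Rightarrow> 'a \<Rightarrow> real" and m :: "'a measure"
    and G :: "('g, 'b) monoid_scheme" and \<phi> :: "'g \<Rightarrow> 'a \<Rightarrow> 'a"
    and K N :: real
  assumes "metric_measure_space M d m"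
    and "1 \<le> N"
    and "metric_measure_space.MCP_loc M d m K N"
    and "metric_measure_space.acts_by_mm_isometries M d m G (discrete_topology (carrier G)) \<phi>"
    and "acts_freely G M \<phi>"
  shows "metric_measure_space (orbits G M \<phi>) (quotient_dist G \<phi> M d) (quotient_measure G \<phi> M d m) \<and>
    metric_measure_space.MCP_loc
      (orbits G M \<phi>) (quotient_dist G \<phi> M d) (quotient_measure G \<phi> M d m) K N \<and>
    (metric_measure_space.delta_essentially_non_branching M d m \<longrightarrow>
     metric_measure_space.delta_essentially_non_branching
       (orbits G M \<phi>) (quotient_dist G \<phi> M d) (quotient_measure G \<phi> M d m))"
proof -
  interpret free_isometric_action M d m G \<phi>
    using assms(1,4,5) by (simp add: free_isometric_action_def free_isometric_action_axioms_def)
  show ?thesis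
    using quotient_metric_measure_space Q_MCP_loc[OF assms(3)] Q_delta_essentially_non_branching
    by blast
qed

end
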